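(* Let $h>0$, let $g$ satisfy (M) and $k_0$ satisfy (K$_0$) (see context), let $c_*^{\pm}$ and $\lambda_*^{\pm}$ be the critical speeds and tangency points defined in the context, and let $u$ be the solution of $$u_t(t,x)=u_{xx}(t,x)-u(t,x)+\int_{\mathbb{R}}k_0(y)\,g(u(t-h,x-y))\,dy,\quad t>0,\ x\in\mathbb{R},$$ with nonnegative initial data $u(s,x)=u_0(s,x)$, $(s,x)\in[-h,0]\times\mathbb{R}$, $u_0\in C([-h,0],L^1(\mathbb{R}))$. (i) If $e^{-\lambda_*^+x}u_0(s,x)$ is bounded in $L^1(\mathbb{R})\cap L^\infty(\mathbb{R})$ (as a function of $x$) uniformly in $s\in[-h,0]$ and $c\ge c_*^+$, then $$\lim_{t\to\infty,\ z\le-ct}u(t,z)=0,\qquad\text{i.e. }\ \sup_{z\le-ct}u(t,z)\to0\ \text{ as }t\to\infty.$$ (ii) If $e^{-\lambda_*^-x}u_0(s,x)$ is bounded in $L^1(\mathbb{R})\cap L^\infty(\mathbb{R})$ (as a function of $x$) uniformly in $s\in[-h,0]$ and $c\le c_*^-$, then $$\lim_{t\to\infty,\ z\ge-ct}u(t,z)=0,\qquad\text{i.e. }\ \sup_{z\ge-ct}u(t,z)\to0\ \text{ as }t\to\infty.$$ In particular, if $c_*^+c_*^->0$ and the (bounded) initial data $u_0$ has compact support, then $\lim_{t\to\infty}u(t,z)=0$ for all $z\in\mathbb{R}$.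
   Context: (M): $g:\mathbb{R}_+\to\mathbb{R}_+$ is a (Lipschitz) function such that $g(x)=x$ has exactly two solutions, $0$ and $\kappa>0$, and $g(u)\le g'(0)u$ for all $u\ge0$. Moreover $g$ is $C^1$ in some $\delta_0$-neighborhood of the equilibria $0,\kappa$, where $g'(0)>1>g'(\kappa)$, and there are $C>0$, $\theta\in(0,1]$ such that $|g'(u)-g'(0)|+|g'(\kappa)-g'(\kappa-u)|\le Cu^\theta$ for $u\in(0,\delta_0]$. (K$_0$): $k_0\ge0$, $\int_{\mathbb{R}}k_0(z)\,dz=1$, and for given $a<0<b$, $\int_{\mathbb{R}}k_0(z)e^{\lambda z}dz<\infty$ for all $\lambda\in(a,b)$. Critical speeds: $c_*^-<c_*^+$ are the numbers such that the set of admissible speeds of semi-wavefronts (nonnegative bounded solutions of the form $u(t,x)=\phi_c(x+ct)$ with $\phi_c(-\infty)=0$ or $\phi_c(+\infty)=0$) is $(-\infty,c_*^-]\cup[c_*^+,+\infty)$. There are values $\lambda_*^-<0<\lambda_*^+$ at which, respectively, the curves $$f_1^{\pm}(z)=-z^2+c_*^{\pm}z+1,\qquad f_2^{\pm}(z)=g'(0)e^{-zc_*^{\pm}h}\int_{\mathbb{R}}k_0(y)e^{-zy}dy$$ are tangent, i.e. $f_1^\pm$ and $f_2^\pm$ have equal values and equal derivatives at $z=\lambda_*^\pm$. Solutions are those obtained by solving successively on $[0,h],[h,2h],\dots$ as an inhomogeneous linear parabolic equation (Duhamel's formula). *)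

theory Defs
  imports "HOL-Analysis.Analysis"
begin

text \<open>
  Condition (M) on the birth function. The half-line is encoded as {0..}, so \<^term>\<open>g\<close> is
  irrelevant on the negative reals and the derivative at 0 is one-sided. The function
  \<^term>\<open>g'\<close> is the derivative near the equilibria 0 and \<^term>\<open>\<kappa>\<close> and is unconstrained elsewhere.
  The radius \<^term>\<open>\<delta>0\<close> may always be shrunk; taking it below \<^term>\<open>\<kappa>\<close> keeps
  the neighbourhood of \<^term>\<open>\<kappa>\<close> inside the half-line.
\<close>

definition condition_M :: "(real \<Rightarrow> real) \<Rightarrow> (real \<Rightarrow> real) \<Rightarrow> real \<Rightarrow> bool" where
  "condition_M g g' \<kappa> \<longleftrightarrow>
     \<kappa> > 0 \<and>
     (\<forall>u\<ge>0. g u \<ge> 0) \<and>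
     (\<exists>L. L-lipschitz_on {0..} g) \<and>
     (\<forall>u\<ge>0. g u = u \<longleftrightarrow> u = 0 \<or> u = \<kappa>) \<and>
     (\<forall>u\<ge>0. g u \<le> g' 0 * u) \<and>
     g' 0 > 1 \<and> 1 > g' \<kappa> \<and>
     (\<exists>\<delta>0 C \<theta>. 0 < \<delta>0 \<and> \<delta>0 < \<kappa> \<and> C > 0 \<and> 0 < \<theta> \<and> \<theta> \<le> 1 \<and>
        (\<forall>u \<in> {0..\<delta>0} \<union> {\<kappa>-\<delta>0..\<kappa>+\<delta>0}.
            (g has_real_derivative g' u) (at u within {0..})) \<and>
        continuous_on ({0..\<delta>0} \<union> {\<kappa>-\<delta>0..\<kappa>+\<delta>0}) g' \<and>
        (\<forall>u. 0 < u \<and> u \<le> \<delta>0 \<longrightarrow>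
            \<bar>g' u - g' 0\<bar> + \<bar>g' \<kappa> - g' (\<kappa> - u)\<bar> \<le> C * u powr \<theta>))"

definition condition_K0 :: "(real \<Rightarrow> real) \<Rightarrow> real \<Rightarrow> real \<Rightarrow> bool" where
  "condition_K0 k0 a b \<longleftrightarrow>
     a < 0 \<and> 0 < b \<and>
     (\<forall>z. k0 z \<ge> 0) \<and>
     has_bochner_integral lborel k0 1 \<and>
     (\<forall>\<mu>. a < \<mu> \<and> \<mu> < b \<longrightarrow> integrable lborel (\<lambda>z. k0 z * exp (\<mu> * z)))"

definition delayed_birth ::
    "real \<Rightarrow> (real \<Rightarrow> real) \<Rightarrow> (real \<Rightarrow> real) \<Rightarrow> (real \<Rightarrow> real \<Rightarrow> real) \<Rightarrow> real \<Rightarrow> real \<Rightarrow> real" where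
  "delayed_birth h k0 g u t x = (\<integral>y. k0 y * g (u (t - h) (x - y)) \<partial>lborel)"

definition entire_solution ::
    "real \<Rightarrow> (real \<Rightarrow> real) \<Rightarrow> (real \<Rightarrow> real) \<Rightarrow> (real \<Rightarrow> real \<Rightarrow> real) \<Rightarrow> bool" where
  "entire_solution h k0 g u \<longleftrightarrow>
     (\<exists>ut ux uxx. \<forall>t x.
        ((\<lambda>s. u s x) has_real_derivative ut t x) (at t) \<and>
        ((\<lambda>y. u t y) has_real_derivative ux t x) (at x) \<and>
        ((\<lambda>y. ux t y) has_real_derivative uxx t x) (at x) \<and>
        ut t x = uxx t x - u t x + delayed_birth h k0 g u t x)"

text \<open>
  The zero profile has to be excluded: it solves the equation for every speed.
\<close>

definition semi_wavefront ::
    "real \<Rightarrow> (real \<Rightarrow> real) \<Rightarrow> (real \<Rightarrow> real) \<Rightarrow> real \<Rightarrow> (real \<Rightarrow> real) \<Rightarrow> bool" where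
  "semi_wavefront h k0 g c \<phi> \<longleftrightarrow>
     (\<forall>z. \<phi> z \<ge> 0) \<and> (\<exists>z. \<phi> z \<noteq> 0) \<and> bounded (range \<phi>) \<and>
     entire_solution h k0 g (\<lambda>t x. \<phi> (x + c * t)) \<and>
     ((\<phi> \<longlongrightarrow> 0) at_bot \<or> (\<phi> \<longlongrightarrow> 0) at_top)"

definition admissible_speeds ::
    "real \<Rightarrow> (real \<Rightarrow> real) \<Rightarrow> (real \<Rightarrow> real) \<Rightarrow> real set" where
  "admissible_speeds h k0 g = {c. \<exists>\<phi>. semi_wavefront h k0 g c \<phi>}"

definition critical_speeds ::
    "real \<Rightarrow> (real \<Rightarrow> real) \<Rightarrow> (real \<Rightarrow> real) \<Rightarrow> real \<Rightarrow> real \<Rightarrow> bool" where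
  "critical_speeds h k0 g cm cp \<longleftrightarrow> cm < cp \<and> admissible_speeds h k0 g = {..cm} \<union> {cp..}"

definition f1 :: "real \<Rightarrow> real \<Rightarrow> real" where
  "f1 c z = - (z^2) + c * z + 1"

text \<open>The argument \<^term>\<open>p\<close> stands for the derivative of the birth function at 0.\<close>

definition f2 :: "real \<Rightarrow> (real \<Rightarrow> real) \<Rightarrow> real \<Rightarrow> real \<Rightarrow> real \<Rightarrow> real" where
  "f2 h k0 p c z = p * exp (- z * c * h) * (\<integral>y. k0 y * exp (- z * y) \<partial>lborel)"

text \<open>
  The interior condition says that the integral in \<^term>\<open>f2\<close> converges near the tangency
  point, so that value and derivative of \<^term>\<open>f2\<close> there are not artefacts of the convention
  that divergent integrals are 0.
\<close>

definition tangency_point ::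
    "real \<Rightarrow> (real \<Rightarrow> real) \<Rightarrow> real \<Rightarrow> real \<Rightarrow> real \<Rightarrow> bool" where
  "tangency_point h k0 p c \<mu> \<longleftrightarrow>
     \<mu> \<in> interior {z. integrable lborel (\<lambda>y. k0 y * exp (- z * y))} \<and>
     f1 c \<mu> = f2 h k0 p c \<mu> \<and>
     (\<exists>D. (f1 c has_real_derivative D) (at \<mu>) \<and> (f2 h k0 p c has_real_derivative D) (at \<mu>))"

definition heat_kernel :: "real \<Rightarrow> real \<Rightarrow> real" where
  "heat_kernel t x = exp (- (x^2) / (4 * t)) / sqrt (4 * pi * t)"

text \<open>
  On each interval [n h, (n+1) h] the delayed term is already known, and the solution is given
  by Duhamel's formula for the semigroup generated by the second derivative minus the identity,
  with initial value at time n h.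
\<close>

definition duhamel_solution ::
    "real \<Rightarrow> (real \<Rightarrow> real) \<Rightarrow> (real \<Rightarrow> real) \<Rightarrow> (real \<Rightarrow> real \<Rightarrow> real) \<Rightarrow> (real \<Rightarrow> real \<Rightarrow> real) \<Rightarrow> bool" where
  "duhamel_solution h k0 g u0 u \<longleftrightarrow>
     (\<forall>s\<in>{-h..0}. \<forall>x. u s x = u0 s x) \<and>
     (\<forall>(n::nat) t x. real n * h < t \<and> t \<le> real (Suc n) * h \<longrightarrow>
        u t x =
          exp (- (t - real n * h)) *
            (\<integral>y. heat_kernel (t - real n * h) (x - y) * u (real n * h) y \<partial>lborel) +
          (LBINT s:{real n * h..t}. exp (- (t - s)) *
            (\<integral>y. heat_kernel (t - s) (x - y) * delayed_birth h k0 g u s y \<partial>lborel)))"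

definition continuous_into_L1 :: "real set \<Rightarrow> (real \<Rightarrow> real \<Rightarrow> real) \<Rightarrow> bool" where
  "continuous_into_L1 I v \<longleftrightarrow>
     (\<forall>s\<in>I. integrable lborel (v s)) \<and>
     (\<forall>s\<in>I. ((\<lambda>r. \<integral>x. \<bar>v r x - v s x\<bar> \<partial>lborel) \<longlongrightarrow> 0) (at s within I))"

definition uniformly_bounded_L1_Linf :: "real set \<Rightarrow> (real \<Rightarrow> real \<Rightarrow> real) \<Rightarrow> bool" where
  "uniformly_bounded_L1_Linf I v \<longleftrightarrow>
     (\<exists>B. \<forall>s\<in>I. integrable lborel (v s) \<and>
        (\<integral>x. \<bar>v s x\<bar> \<partial>lborel) \<le> B \<and> (AE x in lborel. \<bar>v s x\<bar> \<le> B))"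

end

theory Submission
  imports Defs "HOL-Probability.Distributions"
begin

text \<open>
  Fix one of the two critical pairs \<open>(c, l)\<close>, with \<open>l\<close> the tangency point, and let \<open>p = g' 0\<close>.
  As \<open>g v \<le> p v\<close>, the solution is a subsolution of the linearization at 0, and equality of \<open>f1\<close> and
  \<open>f2\<close> at \<open>l\<close> means that \<open>exp (l (x + c t))\<close> solves this linear equation. Dividing by it, the weighted function
  \<open>W t x = exp (- l (x + c t)) u t x\<close> is a subsolution of a linear equation with diffusion, drift, removal at rate
  \<open>q = f1 c l\<close>, and delayed birth at the same rate \<open>q\<close> with a probability density as dispersal kernel
  (\<open>weighted_duhamel_step\<close>). Such an equation creates neither mass nor height: if the data are bounded in
  \<open>L\<^sup>1\<close> and in \<open>L\<^sup>\<infinity>\<close> by \<open>M\<close>, so is \<open>W\<close> at all later times (\<open>W_le_M_and_mass_le_M\<close>).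

  The point is that \<open>W\<close> tends to 0 uniformly in space. Write \<open>W t\<close> by Duhamel's formula from time 0, as an
  average over the time \<open>s\<close> of the last birth (\<open>duhamel\<close>). If \<open>W \<le> m\<close> from some time on, then a birth at time
  \<open>s\<close> contributes at most \<open>m\<close>, but also at most \<open>M / sqrt (4 \<pi> (t - s))\<close>, because the heat kernel spreads a mass
  of at most \<open>M\<close>. Old births have a fixed positive probability and contribute at most \<open>m / 2\<close>, so the
  average is eventually below \<open>\<theta> m\<close> with some \<open>\<theta> < 1\<close> (\<open>contraction_step\<close>). Iteration drives the bound below
  every positive number (\<open>uniform_decay\<close>).

  Where \<open>l (z + c t) \<le> 0\<close> one has \<open>u \<le> W\<close>, so \<open>u\<close> tends to 0 uniformly there. For \<open>l > 0\<close> this is the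
  half-line of part (i), for \<open>l < 0\<close> that of part (ii), and bounded data with compact support satisfy both
  weighted conditions.

  The exchanges of integrals behind these estimates need joint measurability in time and space, whereas the
  data are only continuous into \<open>L\<^sup>1\<close>. They are therefore replaced by a jointly measurable version, with
  no effect on the solution at positive times.
\<close>

section \<open>Convolutions of nonnegative functions\<close>

lemma measurable_joint_comp:
  fixes w :: "real \<Rightarrow> real \<Rightarrow> 'a::topological_space"
  assumes "case_prod w \<in> borel_measurable (borel \<Otimes>\<^sub>M borel)"
    and "f \<in> borel_measurable N" "g \<in> borel_measurable N"
  shows "(\<lambda>p. w (f p) (g p)) \<in> borel_measurable N"
  using measurable_compose[OF measurable_Pair[OF assms(2,3)] assms(1)] by simp

lemma measurable_slice:
  fixes w :: "real \<Rightarrow> real \<Rightarrow> 'a::topological_space"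
  assumes "case_prod w \<in> borel_measurable (borel \<Otimes>\<^sub>M borel)"
  shows "w t \<in> borel_measurable borel"
  by (rule measurable_joint_comp[OF assms, of "\<lambda>_. t" borel "\<lambda>x. x"]) simp_all

definition conv :: "(real \<Rightarrow> ennreal) \<Rightarrow> (real \<Rightarrow> ennreal) \<Rightarrow> real \<Rightarrow> ennreal" where
  "conv f w x = (\<integral>\<^sup>+y. f (x - y) * w y \<partial>lborel)"

lemma measurable_conv [measurable (raw)]:
  assumes [measurable]: "case_prod f \<in> borel_measurable (M \<Otimes>\<^sub>M borel)"
    "case_prod w \<in> borel_measurable (M \<Otimes>\<^sub>M borel)" "\<xi> \<in> borel_measurable M"
  shows "(\<lambda>p. conv (f p) (w p) (\<xi> p)) \<in> borel_measurable M"
  unfolding conv_def by measurable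

lemma conv_mono: "(\<And>y. w y \<le> w' y) \<Longrightarrow> conv f w x \<le> conv f w' x"
  unfolding conv_def by (intro nn_integral_mono mult_left_mono) auto

lemma nn_integral_lborel_reflect:
  fixes f :: "real \<Rightarrow> ennreal"
  assumes [measurable]: "f \<in> borel_measurable borel"
  shows "(\<integral>\<^sup>+y. f (x - y) \<partial>lborel) = (\<integral>\<^sup>+y. f y \<partial>lborel)"
  by (subst nn_integral_real_affine[of f "-1" x]) auto

lemma nn_integral_lborel_shift:
  fixes f :: "real \<Rightarrow> ennreal"
  assumes [measurable]: "f \<in> borel_measurable borel"
  shows "(\<integral>\<^sup>+y. f (y + x) \<partial>lborel) = (\<integral>\<^sup>+y. f y \<partial>lborel)"
  using nn_integral_real_affine[of f 1 x] by (simp add: add.commute)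

lemma conv_swap:
  assumes [measurable]: "f \<in> borel_measurable borel" "w \<in> borel_measurable borel"
  shows "(\<integral>\<^sup>+y. f y * w (x - y) \<partial>lborel) = conv f w x"
  unfolding conv_def
  using nn_integral_lborel_reflect[of "\<lambda>y. f (x - y) * w y" x] by simp

lemma conv_add:
  assumes [measurable]: "f \<in> borel_measurable borel" "v \<in> borel_measurable borel"
    "w \<in> borel_measurable borel"
  shows "conv f (\<lambda>y. v y + w y) x = conv f v x + conv f w x"
  unfolding conv_def by (simp add: distrib_left nn_integral_add)

lemma conv_cmult:
  assumes [measurable]: "f \<in> borel_measurable borel" "w \<in> borel_measurable borel"
  shows "conv f (\<lambda>y. c * w y) x = c * conv f w x"
  unfolding conv_def by (simp add: mult.left_commute[of _ c] nn_integral_cmult)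

lemma conv_nn_integral:
  fixes F :: "real \<Rightarrow> real \<Rightarrow> ennreal"
  assumes [measurable]: "f \<in> borel_measurable borel"
    "case_prod F \<in> borel_measurable (borel \<Otimes>\<^sub>M borel)"
  shows "conv f (\<lambda>y. \<integral>\<^sup>+s. F s y \<partial>lborel) x = (\<integral>\<^sup>+s. conv f (F s) x \<partial>lborel)"
proof -
  have "conv f (\<lambda>y. \<integral>\<^sup>+s. F s y \<partial>lborel) x = (\<integral>\<^sup>+y. \<integral>\<^sup>+s. f (x - y) * F s y \<partial>lborel \<partial>lborel)"
    unfolding conv_def by (intro nn_integral_cong) (simp add: nn_integral_cmult)
  also have "\<dots> = (\<integral>\<^sup>+s. \<integral>\<^sup>+y. f (x - y) * F s y \<partial>lborel \<partial>lborel)"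
    by (intro lborel_pair.Fubini') measurable
  finally show ?thesis by (simp add: conv_def)
qed

lemma conv_le_sup:
  assumes [measurable]: "f \<in> borel_measurable borel"
    and "(\<integral>\<^sup>+y. f y \<partial>lborel) \<le> 1" and "\<And>y. w y \<le> c"
  shows "conv f w x \<le> c"
proof -
  have "conv f w x \<le> (\<integral>\<^sup>+y. f (x - y) * c \<partial>lborel)"
    unfolding conv_def by (intro nn_integral_mono mult_left_mono assms(3)) auto
  also have "\<dots> = (\<integral>\<^sup>+y. f y \<partial>lborel) * c"
    by (simp add: nn_integral_multc nn_integral_lborel_reflect)
  also have "\<dots> \<le> 1 * c" by (intro mult_right_mono assms(2)) auto
  finally show ?thesis by simp
qed

lemma conv_le_mass:
  assumes [measurable]: "w \<in> borel_measurable borel" and "\<And>y. f y \<le> c"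
  shows "conv f w x \<le> c * (\<integral>\<^sup>+y. w y \<partial>lborel)"
proof -
  have "conv f w x \<le> (\<integral>\<^sup>+y. c * w y \<partial>lborel)"
    unfolding conv_def by (intro nn_integral_mono mult_right_mono assms(2)) auto
  then show ?thesis by (simp add: nn_integral_cmult)
qed

lemma conv_mass_le:
  assumes [measurable]: "f \<in> borel_measurable borel" "w \<in> borel_measurable borel"
    and "(\<integral>\<^sup>+y. f y \<partial>lborel) \<le> 1"
  shows "(\<integral>\<^sup>+x. conv f w x \<partial>lborel) \<le> (\<integral>\<^sup>+y. w y \<partial>lborel)"
proof -
  have "(\<integral>\<^sup>+x. conv f w x \<partial>lborel) = (\<integral>\<^sup>+y. \<integral>\<^sup>+x. f (x - y) * w y \<partial>lborel \<partial>lborel)"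
    unfolding conv_def by (intro lborel_pair.Fubini') measurable
  also have "\<dots> = (\<integral>\<^sup>+y. (\<integral>\<^sup>+x. f x \<partial>lborel) * w y \<partial>lborel)"
    using nn_integral_lborel_shift[of f]
    by (intro nn_integral_cong) (simp add: nn_integral_multc diff_conv_add_uminus del: add_uminus_conv_diff)
  also have "\<dots> \<le> (\<integral>\<^sup>+y. 1 * w y \<partial>lborel)"
    by (intro nn_integral_mono mult_right_mono assms(3)) auto
  finally show ?thesis by simp
qed

section \<open>The heat semigroup with drift\<close>

text \<open>
  The Gaussian that results from conjugating the heat kernel with the weight \<open>exp (- l x)\<close>:
  the tilt turns into a drift of speed \<open>2 l\<close> and a scalar factor \<open>exp (l\<^sup>2 s)\<close>, which is left out here.
\<close>

definition drift_heat :: "real \<Rightarrow> real \<Rightarrow> real \<Rightarrow> ennreal" where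
  "drift_heat l s z = ennreal (heat_kernel s (z + 2 * l * s))"

lemma measurable_heat_kernel [measurable (raw)]:
  assumes [measurable]: "f \<in> borel_measurable M" "g \<in> borel_measurable M"
  shows "(\<lambda>p. heat_kernel (f p) (g p)) \<in> borel_measurable M"
  unfolding heat_kernel_def by measurable

lemma measurable_drift_heat [measurable (raw)]:
  assumes [measurable]: "f \<in> borel_measurable M" "g \<in> borel_measurable M"
  shows "(\<lambda>p. drift_heat l (f p) (g p)) \<in> borel_measurable M"
  unfolding drift_heat_def by measurable

lemma heat_kernel_eq_normal_density:
  "s > 0 \<Longrightarrow> heat_kernel s x = normal_density 0 (sqrt (2 * s)) x"
  by (simp add: heat_kernel_def normal_density_def field_simps)

lemma heat_kernel_nonneg: "s \<ge> 0 \<Longrightarrow> heat_kernel s x \<ge> 0"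
  by (simp add: heat_kernel_def)

lemma drift_heat_0 [simp]: "drift_heat l 0 z = 0"
  by (simp add: drift_heat_def heat_kernel_def)

lemma drift_heat_le:
  assumes "s > 0" shows "drift_heat l s z \<le> ennreal (1 / sqrt (4 * pi * s))"
  using assms by (auto simp: drift_heat_def heat_kernel_def intro!: ennreal_leI divide_right_mono)

lemma nn_integral_drift_heat_le:
  assumes "s \<ge> 0" shows "(\<integral>\<^sup>+z. drift_heat l s z \<partial>lborel) \<le> 1"
proof (cases "s = 0")
  case False
  then have s: "s > 0" using assms by simp
  have "(\<integral>\<^sup>+z. drift_heat l s z \<partial>lborel) = (\<integral>\<^sup>+z. ennreal (heat_kernel s z) \<partial>lborel)"
    unfolding drift_heat_def
    using nn_integral_lborel_shift[of "\<lambda>z. ennreal (heat_kernel s z)" "2 * l * s"] by simp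
  also have "\<dots> = ennreal (\<integral>z. normal_density 0 (sqrt (2 * s)) z \<partial>lborel)"
    using s by (subst nn_integral_eq_integral[symmetric]) (auto simp: heat_kernel_eq_normal_density)
  also have "\<dots> = 1" using s by simp
  finally show ?thesis by simp
qed auto

lemma heat_kernel_Chapman_Kolmogorov:
  assumes "s > 0" "r > 0"
  shows "(\<integral>\<^sup>+y. ennreal (heat_kernel s (x - y)) * ennreal (heat_kernel r y) \<partial>lborel)
    = ennreal (heat_kernel (s + r) x)"
proof -
  have "(\<integral>\<^sup>+y. ennreal (normal_density 0 (sqrt (2 * s)) (x - y) * normal_density 0 (sqrt (2 * r)) y) \<partial>lborel)
     = ennreal (normal_density 0 (sqrt ((sqrt (2 * s))\<^sup>2 + (sqrt (2 * r))\<^sup>2)) x)"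
    using assms by (intro conv_normal_density_zero_mean[THEN fun_cong]) auto
  then show ?thesis
    using assms by (simp add: heat_kernel_eq_normal_density ennreal_mult' distrib_left)
qed

text \<open>
  At \<open>r = 0\<close> the kernel is the function 0, not the unit mass, because of division by 0. The inequality
  survives, and it is the direction that upper bounds need.
\<close>

lemma drift_heat_semigroup:
  assumes s: "s > 0" and r: "r \<ge> 0" and [measurable]: "w \<in> borel_measurable borel"
  shows "conv (drift_heat l s) (conv (drift_heat l r) w) x \<le> conv (drift_heat l (s + r)) w x"
proof (cases "r = 0")
  case True
  then show ?thesis by (simp add: conv_def)
next
  case False
  then have r: "r > 0" using r by simp
  \<comment> \<open>The drifts of the two factors add up, so a translation reduces the claim to the centred kernels.\<close>
  have *: "(\<integral>\<^sup>+y. drift_heat l s (x - y) * drift_heat l r (y - z) \<partial>lborel) = drift_heat l (s + r) (x - z)"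
    for z
  proof -
    define f where "f y = ennreal (heat_kernel s (x - z + 2 * l * (s + r) - y)) * ennreal (heat_kernel r y)" for y
    have [measurable]: "f \<in> borel_measurable borel" unfolding f_def by measurable
    have "(\<integral>\<^sup>+y. drift_heat l s (x - y) * drift_heat l r (y - z) \<partial>lborel) = (\<integral>\<^sup>+y. f (y + (2 * l * r - z)) \<partial>lborel)"
      unfolding f_def drift_heat_def by (intro nn_integral_cong) (simp add: algebra_simps)
    also have "\<dots> = (\<integral>\<^sup>+y. f y \<partial>lborel)" by (rule nn_integral_lborel_shift) simp
    also have "\<dots> = drift_heat l (s + r) (x - z)"
      unfolding f_def drift_heat_def by (rule heat_kernel_Chapman_Kolmogorov[OF s r])
    finally show ?thesis .
  qed
  have "conv (drift_heat l s) (conv (drift_heat l r) w) x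
    = (\<integral>\<^sup>+y. \<integral>\<^sup>+z. drift_heat l s (x - y) * (drift_heat l r (y - z) * w z) \<partial>lborel \<partial>lborel)"
    unfolding conv_def by (intro nn_integral_cong) (simp add: nn_integral_cmult)
  also have "\<dots> = (\<integral>\<^sup>+z. \<integral>\<^sup>+y. (drift_heat l s (x - y) * drift_heat l r (y - z)) * w z \<partial>lborel \<partial>lborel)"
    by (subst lborel_pair.Fubini') (auto simp: mult.assoc)
  also have "\<dots> = (\<integral>\<^sup>+z. drift_heat l (s + r) (x - z) * w z \<partial>lborel)"
    by (intro nn_integral_cong) (simp add: nn_integral_multc *)
  finally show ?thesis by (simp add: conv_def)
qed

section \<open>Decay of subsolutions of the linear delay equation\<close>

text \<open>
  An abstract form of the weighted problem: a substance diffuses with drift, each particle is removed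
  at rate \<open>q\<close>, and after the delay it is reborn at a place displaced according to the kernel \<open>K\<close>. A birth
  term with the same rate \<open>q\<close> and with \<open>K\<close> of mass at most 1 creates no mass, so only diffusion acts on
  the size of \<open>W\<close>. The values are extended nonnegative reals, which makes all integrals exist and all
  exchanges of integrals legitimate.
\<close>

locale delayed_subsolution =
  fixes h q l M :: real and K :: "real \<Rightarrow> ennreal" and W :: "real \<Rightarrow> real \<Rightarrow> ennreal"
  assumes h: "h > 0" and q: "q > 0" and M: "M \<ge> 0"
    and K [measurable]: "K \<in> borel_measurable borel" and mass_K: "(\<integral>\<^sup>+z. K z \<partial>lborel) \<le> 1"
    and W [measurable]: "case_prod W \<in> borel_measurable (borel \<Otimes>\<^sub>M borel)"
    and init_sup: "\<And>t x. - h \<le> t \<Longrightarrow> t \<le> 0 \<Longrightarrow> W t x \<le> ennreal M"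
    and init_mass: "\<And>t. - h \<le> t \<Longrightarrow> t \<le> 0 \<Longrightarrow> (\<integral>\<^sup>+x. W t x \<partial>lborel) \<le> ennreal M"
    and duhamel_step: "\<And>(n::nat) t x. real n * h < t \<Longrightarrow> t \<le> real (Suc n) * h \<Longrightarrow>
      W t x \<le> ennreal (exp (- q * (t - real n * h))) * conv (drift_heat l (t - real n * h)) (W (real n * h)) x
        + (\<integral>\<^sup>+s. ennreal (q * exp (- q * (t - s))) * indicator {real n * h<..t} s *
             conv (drift_heat l (t - s)) (conv K (W (s - h))) x \<partial>lborel)"
begin

lemmas W_slice [measurable] = measurable_slice[OF W]
lemmas W_comp [measurable (raw)] = measurable_joint_comp[OF W]

text \<open>
  Over one delay interval diffusion acts only for a time \<open>h\<close>, which bounds the decay that a single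
  Duhamel formula can show. Gluing the formulas by the semigroup property gives one that starts at
  time 0 and contains kernels of arbitrarily large age.
\<close>

lemma duhamel:
  assumes "0 < t"
  shows "W t x \<le> ennreal (exp (- q * t)) * conv (drift_heat l t) (W 0) x
        + (\<integral>\<^sup>+s. ennreal (q * exp (- q * (t - s))) * indicator {0<..t} s *
             conv (drift_heat l (t - s)) (conv K (W (s - h))) x \<partial>lborel)"
proof -
  have "\<forall>t x. 0 < t \<and> t \<le> real n * h \<longrightarrow> W t x \<le> ennreal (exp (- q * t)) * conv (drift_heat l t) (W 0) x
        + (\<integral>\<^sup>+s. ennreal (q * exp (- q * (t - s))) * indicator {0<..t} s *
             conv (drift_heat l (t - s)) (conv K (W (s - h))) x \<partial>lborel)" for n
  proof (induction n)
    case 0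
    then show ?case by auto
  next
    case (Suc n)
    show ?case
    proof (intro allI impI)
      fix t x assume t: "0 < t \<and> t \<le> real (Suc n) * h"
      define a where "a = real n * h"
      show "W t x \<le> ennreal (exp (- q * t)) * conv (drift_heat l t) (W 0) x
        + (\<integral>\<^sup>+s. ennreal (q * exp (- q * (t - s))) * indicator {0<..t} s *
             conv (drift_heat l (t - s)) (conv K (W (s - h))) x \<partial>lborel)"
      proof (cases "t \<le> a \<or> n = 0")
        case True
        then show ?thesis
          using Suc.IH t duhamel_step[of 0 t x] by (auto simp: a_def)
      next
        case False
        then have a: "0 < a" "a < t" using h by (auto simp: a_def)
        define J where "J s y = ennreal (q * exp (- q * (a - s))) * indicator {0<..a} s *
             conv (drift_heat l (a - s)) (conv K (W (s - h))) y" for s y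
        have J[measurable]: "case_prod J \<in> borel_measurable (borel \<Otimes>\<^sub>M borel)"
          unfolding J_def by measurable
        have [measurable]: "J s \<in> borel_measurable borel" for s
          unfolding J_def by measurable
        let ?P = "drift_heat l (t - a)"
        have "conv ?P (W a) x \<le> conv ?P (\<lambda>y. ennreal (exp (- q * a)) * conv (drift_heat l a) (W 0) y
            + (\<integral>\<^sup>+s. J s y \<partial>lborel)) x"
          using Suc.IH a by (intro conv_mono) (auto simp: J_def a_def)
        also have "\<dots> = ennreal (exp (- q * a)) * conv ?P (conv (drift_heat l a) (W 0)) x
            + (\<integral>\<^sup>+s. conv ?P (J s) x \<partial>lborel)"
          by (simp add: conv_add conv_cmult conv_nn_integral)
        also have "\<dots> \<le> ennreal (exp (- q * a)) * conv (drift_heat l t) (W 0) x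
            + (\<integral>\<^sup>+s. ennreal (q * exp (- q * (a - s))) * indicator {0<..a} s *
             conv (drift_heat l (t - s)) (conv K (W (s - h))) x \<partial>lborel)"
        proof (intro add_mono mult_left_mono nn_integral_mono)
          show "conv ?P (conv (drift_heat l a) (W 0)) x \<le> conv (drift_heat l t) (W 0) x"
            using drift_heat_semigroup[of "t - a" a "W 0" l x] a by simp
          fix s
          show "conv ?P (J s) x \<le> ennreal (q * exp (- q * (a - s))) * indicator {0<..a} s *
             conv (drift_heat l (t - s)) (conv K (W (s - h))) x"
          proof (cases "s \<in> {0<..a}")
            case True
            then show ?thesis
              using drift_heat_semigroup[of "t - a" "a - s" "conv K (W (s - h))" l x] a
              unfolding J_def by (subst conv_cmult) (auto intro!: mult_left_mono)
          next
            case False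
            then show ?thesis by (simp add: J_def conv_def)
          qed
        qed auto
        finally have *: "conv ?P (W a) x \<le> \<dots>" .
        have e: "ennreal (exp (- q * (t - a))) * ennreal (exp (- q * a)) = ennreal (exp (- q * t))"
          "ennreal (exp (- q * (t - a))) * ennreal (q * exp (- q * (a - s))) = ennreal (q * exp (- q * (t - s)))" for s
          using q by (auto simp: ennreal_mult'[symmetric] exp_add[symmetric] mult.left_commute algebra_simps)
        have "W t x \<le> ennreal (exp (- q * (t - a))) * conv ?P (W a) x
          + (\<integral>\<^sup>+s. ennreal (q * exp (- q * (t - s))) * indicator {a<..t} s *
             conv (drift_heat l (t - s)) (conv K (W (s - h))) x \<partial>lborel)"
          using duhamel_step[of n t x] a t by (simp add: a_def)
        also have "\<dots> \<le> ennreal (exp (- q * (t - a))) * (ennreal (exp (- q * a)) * conv (drift_heat l t) (W 0) x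
            + (\<integral>\<^sup>+s. ennreal (q * exp (- q * (a - s))) * indicator {0<..a} s *
             conv (drift_heat l (t - s)) (conv K (W (s - h))) x \<partial>lborel))
          + (\<integral>\<^sup>+s. ennreal (q * exp (- q * (t - s))) * indicator {a<..t} s *
             conv (drift_heat l (t - s)) (conv K (W (s - h))) x \<partial>lborel)"
          by (intro add_mono mult_left_mono *) auto
        also have "\<dots> = ennreal (exp (- q * t)) * conv (drift_heat l t) (W 0) x
            + ((\<integral>\<^sup>+s. ennreal (q * exp (- q * (t - s))) * indicator {0<..a} s *
             conv (drift_heat l (t - s)) (conv K (W (s - h))) x \<partial>lborel)
          + (\<integral>\<^sup>+s. ennreal (q * exp (- q * (t - s))) * indicator {a<..t} s *
             conv (drift_heat l (t - s)) (conv K (W (s - h))) x \<partial>lborel))"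
          by (simp only: distrib_left e mult.assoc[symmetric] nn_integral_cmult[symmetric] add.assoc)
             (subst nn_integral_cmult[symmetric], measurable, simp only: e mult.assoc[symmetric])
        also have "(\<integral>\<^sup>+s. ennreal (q * exp (- q * (t - s))) * indicator {0<..a} s *
             conv (drift_heat l (t - s)) (conv K (W (s - h))) x \<partial>lborel)
          + (\<integral>\<^sup>+s. ennreal (q * exp (- q * (t - s))) * indicator {a<..t} s *
             conv (drift_heat l (t - s)) (conv K (W (s - h))) x \<partial>lborel)
          = (\<integral>\<^sup>+s. ennreal (q * exp (- q * (t - s))) * indicator {0<..t} s *
             conv (drift_heat l (t - s)) (conv K (W (s - h))) x \<partial>lborel)"
          using a by (subst nn_integral_add[symmetric], measurable)
             (auto intro!: nn_integral_cong simp: indicator_def)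
        finally show ?thesis .
      qed
    qed
  qed
  moreover obtain n where "t \<le> real n * h"
    using h by (metis reals_Archimedean3 less_imp_le)
  ultimately show ?thesis using assms by blast
qed

text \<open>
  The weights \<open>q exp (- q (t - s))\<close> are the density of the time of the last birth before \<open>t\<close>; with the weight
  \<open>exp (- q t)\<close> of no birth they add up to 1. Hence the Duhamel formula is an average, and every bound on the
  past is inherited.
\<close>

lemma nn_integral_waiting_time:
  assumes "a \<le> b"
  shows "(\<integral>\<^sup>+s. ennreal (q * exp (- q * (t - s))) * indicator {a<..b} s \<partial>lborel)
    = ennreal (exp (- q * (t - b)) - exp (- q * (t - a)))"
proof -
  have "(\<integral>\<^sup>+s. ennreal (q * exp (- q * (t - s))) * indicator {a<..b} s \<partial>lborel)
      = (\<integral>\<^sup>+s. ennreal (q * exp (- q * (t - s))) * indicator {a..b} s \<partial>lborel)"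
    by (intro nn_integral_cong_AE eventually_mono[OF AE_lborel_singleton[of a]])
       (auto simp: indicator_def)
  also have "\<dots> = ennreal (exp (- q * (t - b)) - exp (- q * (t - a)))"
    using assms q by (intro nn_integral_FTC_Icc) (auto intro!: derivative_eq_intros)
  finally show ?thesis .
qed

lemma nn_integral_waiting_time_le:
  assumes "a \<le> b" and "\<And>s. a < s \<Longrightarrow> s \<le> b \<Longrightarrow> f s \<le> ennreal c" and "c \<ge> 0"
  shows "(\<integral>\<^sup>+s. ennreal (q * exp (- q * (t - s))) * indicator {a<..b} s * f s \<partial>lborel)
    \<le> ennreal (c * (exp (- q * (t - b)) - exp (- q * (t - a))))"
proof -
  have "(\<integral>\<^sup>+s. ennreal (q * exp (- q * (t - s))) * indicator {a<..b} s * f s \<partial>lborel)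
    \<le> (\<integral>\<^sup>+s. ennreal (q * exp (- q * (t - s))) * indicator {a<..b} s * ennreal c \<partial>lborel)"
    by (intro nn_integral_mono) (auto simp: indicator_def intro!: mult_left_mono assms(2))
  also have "\<dots> = ennreal (c * (exp (- q * (t - b)) - exp (- q * (t - a))))"
    using assms by (subst nn_integral_multc, measurable)
      (simp only: nn_integral_waiting_time mult.commute[of _ "ennreal c"] ennreal_mult'[symmetric])
  finally show ?thesis .
qed

lemma W_le_M_and_mass_le_M:
  assumes "- h \<le> t"
  shows "W t x \<le> ennreal M" and "(\<integral>\<^sup>+x. W t x \<partial>lborel) \<le> ennreal M"
proof -
  have "\<forall>t. - h \<le> t \<and> t \<le> real n * h \<longrightarrow>
      (\<forall>x. W t x \<le> ennreal M) \<and> (\<integral>\<^sup>+x. W t x \<partial>lborel) \<le> ennreal M" for n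
  proof (induction n)
    case 0
    then show ?case using init_sup init_mass by auto
  next
    case (Suc n)
    show ?case
    proof (intro allI impI)
      fix t assume t: "- h \<le> t \<and> t \<le> real (Suc n) * h"
      show "(\<forall>x. W t x \<le> ennreal M) \<and> (\<integral>\<^sup>+x. W t x \<partial>lborel) \<le> ennreal M"
      proof (cases "t \<le> 0")
        case True
        then show ?thesis using init_sup init_mass t by auto
      next
        case False
        then have t0: "0 < t" by simp
        have past_sup: "W (s - h) y \<le> ennreal M"
          and past_mass: "(\<integral>\<^sup>+x. W (s - h) x \<partial>lborel) \<le> ennreal M" if "0 < s" "s \<le> t" for s y
          using Suc.IH[rule_format, of "s - h"] that t by (auto simp: algebra_simps)
        have sum_M: "ennreal (exp (- q * t)) * ennreal M + ennreal (M * (exp (- q * (t - t)) - exp (- q * (t - 0)))) = ennreal M"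
          using M t0 q by (subst ennreal_mult'[symmetric], simp, subst ennreal_plus[symmetric])
            (auto intro!: mult_nonneg_nonneg mult_left_le simp: right_diff_distrib)
        have "W t x \<le> ennreal M" for x
        proof -
          have "W t x \<le> ennreal (exp (- q * t)) * ennreal M + ennreal (M * (exp (- q * (t - t)) - exp (- q * (t - 0))))"
            using t0 M h
            by (intro order_trans[OF duhamel[OF t0]] add_mono mult_left_mono nn_integral_waiting_time_le
                  conv_le_sup nn_integral_drift_heat_le mass_K past_sup init_sup) auto
          then show ?thesis by (simp only: sum_M)
        qed
        moreover have "(\<integral>\<^sup>+x. W t x \<partial>lborel) \<le> ennreal M"
        proof -
          let ?F = "\<lambda>s x. conv (drift_heat l (t - s)) (conv K (W (s - h))) x"
          have "(\<integral>\<^sup>+x. W t x \<partial>lborel)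
            \<le> (\<integral>\<^sup>+x. (ennreal (exp (- q * t)) * conv (drift_heat l t) (W 0) x
               + (\<integral>\<^sup>+s. ennreal (q * exp (- q * (t - s))) * indicator {0<..t} s * ?F s x \<partial>lborel)) \<partial>lborel)"
            by (intro nn_integral_mono duhamel t0)
          also have "\<dots> = ennreal (exp (- q * t)) * (\<integral>\<^sup>+x. conv (drift_heat l t) (W 0) x \<partial>lborel)
             + (\<integral>\<^sup>+x. \<integral>\<^sup>+s. ennreal (q * exp (- q * (t - s))) * indicator {0<..t} s * ?F s x \<partial>lborel \<partial>lborel)"
            by (subst nn_integral_add) (auto simp: nn_integral_cmult)
          also have "(\<integral>\<^sup>+x. \<integral>\<^sup>+s. ennreal (q * exp (- q * (t - s))) * indicator {0<..t} s * ?F s x \<partial>lborel \<partial>lborel)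
             = (\<integral>\<^sup>+s. \<integral>\<^sup>+x. ennreal (q * exp (- q * (t - s))) * indicator {0<..t} s * ?F s x \<partial>lborel \<partial>lborel)"
            by (intro lborel_pair.Fubini') measurable
          also have "\<dots> = (\<integral>\<^sup>+s. ennreal (q * exp (- q * (t - s))) * indicator {0<..t} s * (\<integral>\<^sup>+x. ?F s x \<partial>lborel) \<partial>lborel)"
            by (intro nn_integral_cong nn_integral_cmult) measurable
          also have "ennreal (exp (- q * t)) * (\<integral>\<^sup>+x. conv (drift_heat l t) (W 0) x \<partial>lborel) + \<dots>
            \<le> ennreal (exp (- q * t)) * ennreal M + ennreal (M * (exp (- q * (t - t)) - exp (- q * (t - 0))))"
          proof (intro add_mono mult_left_mono nn_integral_waiting_time_le)
            show "(\<integral>\<^sup>+x. conv (drift_heat l t) (W 0) x \<partial>lborel) \<le> ennreal M"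
              using t0 h by (intro order_trans[OF conv_mass_le init_mass] nn_integral_drift_heat_le) auto
            fix s assume s: "0 < s" "s \<le> t"
            have "(\<integral>\<^sup>+x. ?F s x \<partial>lborel) \<le> (\<integral>\<^sup>+x. conv K (W (s - h)) x \<partial>lborel)"
              using s by (intro conv_mass_le nn_integral_drift_heat_le) auto
            also have "\<dots> \<le> (\<integral>\<^sup>+x. W (s - h) x \<partial>lborel)"
              by (intro conv_mass_le mass_K) auto
            also have "\<dots> \<le> ennreal M" by (rule past_mass[OF s])
            finally show "(\<integral>\<^sup>+x. ?F s x \<partial>lborel) \<le> ennreal M" .
          qed (use t0 M in auto)
          finally show ?thesis by (simp only: sum_M)
        qed
        ultimately show ?thesis by blast
      qed
    qed
  qed
  moreover obtain n where "t \<le> real n * h"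
    using h by (metis reals_Archimedean3 less_imp_le)
  ultimately show "W t x \<le> ennreal M" "(\<integral>\<^sup>+x. W t x \<partial>lborel) \<le> ennreal M"
    using assms by blast+
qed

text \<open>
  A birth at time \<open>s\<close> contributes at most \<open>m\<close>, by the bound on the past, but also at most
  \<open>M / sqrt (4 \<pi> (t - s))\<close>, because the kernel of age \<open>t - s\<close> spreads a mass of at most \<open>M\<close>. Once the age
  exceeds \<open>\<sigma>\<close>, the second bound is below \<open>m / 2\<close>, and ages above \<open>\<sigma>\<close> have the fixed probability
  \<open>exp (- q \<sigma>)\<close>. Births so early that the bound \<open>m\<close> on the past does not apply cost an exponentially small term.
\<close>

lemma contraction_step:
  assumes \<sigma>: "\<sigma> > 0" and half: "M / sqrt (4 * pi * \<sigma>) \<le> m / 2"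
    and T: "T \<ge> 0" and bound: "\<And>t x. t \<ge> T \<Longrightarrow> W t x \<le> ennreal m"
    and t: "t \<ge> T + h + \<sigma>"
  shows "W t x \<le> ennreal (M * exp (- q * (t - T - h)) + m * (1 - exp (- q * \<sigma>) / 2))"
proof -
  \<comment> \<open>Births before a see the past before T; those after b are too young for diffusion to help.\<close>
  define a b where "a = T + h" and "b = t - \<sigma>"
  have ab: "0 < a" "a \<le> b" "b \<le> t" using assms h by (auto simp: a_def b_def)
  have m: "m \<ge> 0"
  proof -
    have "0 \<le> M / sqrt (4 * pi * \<sigma>)" using M \<sigma> by simp
    then show ?thesis using half by linarith
  qed
  let ?F = "\<lambda>s. conv (drift_heat l (t - s)) (conv K (W (s - h))) x"
  let ?k = "\<lambda>A s. ennreal (q * exp (- q * (t - s))) * indicator A s * ?F s"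
  have F_sup: "?F s \<le> ennreal c" if "\<And>y. W (s - h) y \<le> ennreal c" "s \<le> t" for s c
    using that by (intro conv_le_sup nn_integral_drift_heat_le mass_K) auto
  have 1: "integral\<^sup>N lborel (?k {0<..a}) \<le> ennreal (M * (exp (- q * (t - a)) - exp (- q * (t - 0))))"
    using ab M by (intro nn_integral_waiting_time_le F_sup W_le_M_and_mass_le_M) auto
  have 2: "integral\<^sup>N lborel (?k {a<..b}) \<le> ennreal (m / 2 * (exp (- q * (t - b)) - exp (- q * (t - a))))"
  proof (intro nn_integral_waiting_time_le)
    fix s assume s: "a < s" "s \<le> b"
    have "?F s \<le> ennreal (1 / sqrt (4 * pi * (t - s))) * (\<integral>\<^sup>+y. conv K (W (s - h)) y \<partial>lborel)"
      using s \<sigma> by (intro conv_le_mass drift_heat_le) (auto simp: b_def)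
    also have "\<dots> \<le> ennreal (1 / sqrt (4 * pi * \<sigma>)) * ennreal M"
    proof (intro mult_mono)
      have "(\<integral>\<^sup>+y. conv K (W (s - h)) y \<partial>lborel) \<le> (\<integral>\<^sup>+y. W (s - h) y \<partial>lborel)"
        by (intro conv_mass_le mass_K) auto
      also have "\<dots> \<le> ennreal M" using s ab by (intro W_le_M_and_mass_le_M) auto
      finally show "(\<integral>\<^sup>+y. conv K (W (s - h)) y \<partial>lborel) \<le> ennreal M" .
      show "ennreal (1 / sqrt (4 * pi * (t - s))) \<le> ennreal (1 / sqrt (4 * pi * \<sigma>))"
        using s \<sigma> by (intro ennreal_leI divide_left_mono) (auto simp: b_def)
    qed auto
    also have "\<dots> = ennreal (M / sqrt (4 * pi * \<sigma>))"
      using M \<sigma> by (simp add: ennreal_mult'[symmetric])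
    also have "\<dots> \<le> ennreal (m / 2)" by (intro ennreal_leI half)
    finally show "?F s \<le> ennreal (m / 2)" .
  qed (use ab m in auto)
  have 3: "integral\<^sup>N lborel (?k {b<..t}) \<le> ennreal (m * (exp (- q * (t - t)) - exp (- q * (t - b))))"
    using ab m by (intro nn_integral_waiting_time_le F_sup bound) (auto simp: a_def)
  have "integral\<^sup>N lborel (?k {0<..t})
     = (\<integral>\<^sup>+s. ?k {0<..a} s + (?k {a<..b} s + ?k {b<..t} s) \<partial>lborel)"
    using ab by (intro nn_integral_cong) (auto simp: indicator_def)
  also have "\<dots> = integral\<^sup>N lborel (?k {0<..a}) + (integral\<^sup>N lborel (?k {a<..b}) + integral\<^sup>N lborel (?k {b<..t}))"
    by (simp add: nn_integral_add)
  also have "\<dots> \<le> ennreal (M * (exp (- q * (t - a)) - exp (- q * (t - 0))))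
      + (ennreal (m / 2 * (exp (- q * (t - b)) - exp (- q * (t - a))))
      + ennreal (m * (exp (- q * (t - t)) - exp (- q * (t - b)))))"
    by (intro add_mono 1 2 3)
  finally have I: "integral\<^sup>N lborel (?k {0<..t}) \<le> \<dots>" .
  have mono: "exp (- q * (t - 0)) \<le> exp (- q * (t - a))" "exp (- q * (t - a)) \<le> exp (- q * (t - b))"
     "exp (- q * (t - b)) \<le> 1"
    using ab q by auto
  have "conv (drift_heat l t) (W 0) x \<le> ennreal M"
    using ab h by (intro conv_le_sup nn_integral_drift_heat_le init_sup) auto
  then have "W t x \<le> ennreal (exp (- q * t)) * ennreal M + integral\<^sup>N lborel (?k {0<..t})"
    using ab by (intro order_trans[OF duhamel] add_mono mult_left_mono) auto
  also have "\<dots> \<le> ennreal (exp (- q * t)) * ennreal M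
      + (ennreal (M * (exp (- q * (t - a)) - exp (- q * (t - 0))))
      + (ennreal (m / 2 * (exp (- q * (t - b)) - exp (- q * (t - a))))
      + ennreal (m * (exp (- q * (t - t)) - exp (- q * (t - b))))))"
    by (intro add_mono I) auto
  also have "\<dots> = ennreal (exp (- q * t) * M
      + (M * (exp (- q * (t - a)) - exp (- q * (t - 0)))
      + (m / 2 * (exp (- q * (t - b)) - exp (- q * (t - a)))
      + m * (exp (- q * (t - t)) - exp (- q * (t - b))))))"
    using M m mono by (simp add: ennreal_mult' ennreal_plus)
  also have "\<dots> \<le> ennreal (M * exp (- q * (t - T - h)) + m * (1 - exp (- q * \<sigma>) / 2))"
  proof (intro ennreal_leI)
    have "m / 2 * exp (- q * (t - a)) \<ge> 0" using m by simp
    then show "exp (- q * t) * M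
      + (M * (exp (- q * (t - a)) - exp (- q * (t - 0)))
      + (m / 2 * (exp (- q * (t - b)) - exp (- q * (t - a)))
      + m * (exp (- q * (t - t)) - exp (- q * (t - b)))))
      \<le> M * exp (- q * (t - T - h)) + m * (1 - exp (- q * \<sigma>) / 2)"
      by (simp add: a_def b_def algebra_simps)
  qed
  finally show ?thesis .
qed

text \<open>
  With one threshold \<open>\<sigma>\<close> for all \<open>m \<ge> \<epsilon>\<close>, the contraction step lowers every eventual bound above \<open>\<epsilon>\<close>
  by one and the same factor, so finitely many steps lead from \<open>M\<close> to \<open>\<epsilon>\<close>.
\<close>

lemma uniform_decay:
  assumes \<epsilon>: "\<epsilon> > 0"
  shows "\<exists>T\<ge>0. \<forall>t\<ge>T. \<forall>x. W t x \<le> ennreal \<epsilon>"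
proof -
  \<comment> \<open>Since \<pi> > 1, this makes sqrt (4 \<pi> \<sigma>) at least 2 M / \<epsilon>; the summand 1 keeps \<sigma> positive when M = 0.\<close>
  define \<sigma> where "\<sigma> = (M / \<epsilon>)\<^sup>2 + 1"
  define \<eta> where "\<eta> = exp (- q * \<sigma>) / 2"
  have \<sigma>: "\<sigma> > 0" by (simp add: \<sigma>_def add_nonneg_pos)
  have \<eta>: "0 < \<eta>" "\<eta> < 1"
  proof -
    have "exp (- q * \<sigma>) \<le> 1" using q \<sigma> by simp
    then have "exp (- q * \<sigma>) < 2" by linarith
    then show "0 < \<eta>" "\<eta> < 1" unfolding \<eta>_def by (simp_all del: mult_minus_left)
  qed
  have half: "M / sqrt (4 * pi * \<sigma>) \<le> \<epsilon> / 2"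
  proof -
    have "2 * (M / \<epsilon>) = sqrt (4 * (M / \<epsilon>)\<^sup>2)"
      using M \<epsilon> by (simp add: real_sqrt_mult)
    also have "\<dots> \<le> sqrt (4 * pi * \<sigma>)"
    proof (intro real_sqrt_le_mono)
      have "4 * (M / \<epsilon>)\<^sup>2 \<le> 4 * \<sigma>" by (simp add: \<sigma>_def)
      also have "\<dots> \<le> 4 * pi * \<sigma>" using \<sigma> pi_gt3 by (intro mult_right_mono) auto
      finally show "4 * (M / \<epsilon>)\<^sup>2 \<le> 4 * pi * \<sigma>" .
    qed
    finally have "2 * (M / \<epsilon>) \<le> sqrt (4 * pi * \<sigma>)" .
    then show ?thesis using \<epsilon> \<sigma> by (simp add: field_simps)
  qed
  \<comment> \<open>Half of the gain \<eta> pays for the exponentially small term of the contraction step.\<close>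
  define m where "m k = max \<epsilon> (M * (1 - \<eta> / 2) ^ k)" for k :: nat
  have m_pos: "m k > 0" for k using \<epsilon> by (simp add: m_def)
  have "\<exists>T\<ge>0. \<forall>t\<ge>T. \<forall>x. W t x \<le> ennreal (m k)" for k
  proof (induction k)
    case 0
    show ?case
    proof (intro exI[of _ 0] conjI allI impI)
      fix t x assume "0 \<le> (t::real)"
      then have "W t x \<le> ennreal M" using h by (intro W_le_M_and_mass_le_M) simp
      also have "\<dots> \<le> ennreal (m 0)" by (intro ennreal_leI) (simp add: m_def)
      finally show "W t x \<le> ennreal (m 0)" .
    qed simp
  next
    case (Suc k)
    then obtain T where T: "T \<ge> 0" "\<And>t x. t \<ge> T \<Longrightarrow> W t x \<le> ennreal (m k)" by blast
    define \<delta> where "\<delta> = m k * \<eta> / 2"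
    have \<delta>: "\<delta> > 0" using m_pos \<eta> by (simp add: \<delta>_def)
    \<comment> \<open>From exp (q y) \<ge> q y, the early births contribute at most \<delta> once y \<ge> r.\<close>
    define r where "r = M / (\<delta> * q)"
    have r: "r \<ge> 0" using M \<delta> q by (simp add: r_def)
    have small: "M * exp (- q * y) \<le> \<delta>" if "y \<ge> r" for y
    proof -
      have "M = \<delta> * (q * r)" using \<delta> q by (simp add: r_def)
      also have "\<dots> \<le> \<delta> * (q * y)" using \<delta> q that by (intro mult_left_mono) auto
      also have "\<dots> \<le> \<delta> * exp (q * y)"
        using \<delta> exp_ge_add_one_self[of "q * y"] by (intro mult_left_mono) linarith+
      finally show ?thesis by (simp add: exp_minus field_simps)
    qed
    show ?case
    proof (intro exI[of _ "T + h + \<sigma> + r"] conjI allI impI)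
      fix t x assume t: "T + h + \<sigma> + r \<le> t"
      have "W t x \<le> ennreal (M * exp (- q * (t - T - h)) + m k * (1 - exp (- q * \<sigma>) / 2))"
      proof (rule contraction_step[OF \<sigma> _ T])
        show "M / sqrt (4 * pi * \<sigma>) \<le> m k / 2" using half by (simp add: m_def)
      qed (use t r in auto)
      also have "\<dots> \<le> ennreal (m (Suc k))"
      proof (intro ennreal_leI)
        have "M * exp (- q * (t - T - h)) + m k * (1 - exp (- q * \<sigma>) / 2) \<le> \<delta> + m k * (1 - \<eta>)"
          using small[of "t - T - h"] t \<sigma> by (simp add: \<eta>_def)
        also have "\<dots> = m k * (1 - \<eta> / 2)" by (simp add: \<delta>_def algebra_simps)
        also have "\<dots> \<le> m (Suc k)"
        proof -
          have "\<epsilon> * (1 - \<eta> / 2) \<le> \<epsilon>" using \<epsilon> \<eta> by (simp add: mult_left_le)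
          moreover have "m k * (1 - \<eta> / 2) = max (\<epsilon> * (1 - \<eta> / 2)) (M * (1 - \<eta> / 2) ^ k * (1 - \<eta> / 2))"
            using \<eta> unfolding m_def by (simp add: max_mult_distrib_right)
          ultimately show ?thesis unfolding m_def by (simp add: mult_ac max.coboundedI1)
        qed
        finally show "M * exp (- q * (t - T - h)) + m k * (1 - exp (- q * \<sigma>) / 2) \<le> m (Suc k)" .
      qed
      finally show "W t x \<le> ennreal (m (Suc k))" .
    qed (use T h \<sigma> r in auto)
  qed
  moreover obtain k where "m k = \<epsilon>"
  proof -
    have "(\<lambda>k. M * (1 - \<eta> / 2) ^ k) \<longlonglongrightarrow> M * 0"
      using \<eta> by (intro tendsto_mult_left LIMSEQ_realpow_zero) auto
    then have "\<forall>\<^sub>F k in sequentially. M * (1 - \<eta> / 2) ^ k < \<epsilon>"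
      using \<epsilon> by (intro order_tendstoD(2)) auto
    then obtain k where "M * (1 - \<eta> / 2) ^ k < \<epsilon>" by (auto simp: eventually_sequentially)
    then show ?thesis by (intro that[of k]) (simp add: m_def)
  qed
  ultimately show ?thesis by metis
qed

end

section \<open>Jointly measurable versions\<close>

lemma continuous_into_L1_measurable:
  assumes "continuous_into_L1 I v" "s \<in> I"
  shows "v s \<in> borel_measurable borel"
proof -
  have "integrable lborel (v s)" using assms unfolding continuous_into_L1_def by blast
  then show ?thesis using borel_measurable_integrable by fastforce
qed

text \<open>
  Continuity into \<open>L\<^sup>1\<close> controls each time slice only up to a null set that may depend on the time, so
  \<open>v\<close> itself can fail to be jointly measurable. Replacing each slice by one of countably many slices
  that lies within \<open>2\<^sup>-\<^sup>k\<close> of it gives jointly measurable approximants; as the distances are summable,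
  these converge almost everywhere for every fixed time.
\<close>

lemma continuous_L1_jointly_measurable_version:
  fixes v :: "real \<Rightarrow> real \<Rightarrow> real"
  assumes v: "continuous_into_L1 {a..b} v"
  shows "\<exists>V. case_prod V \<in> borel_measurable (borel \<Otimes>\<^sub>M borel) \<and>
    (\<forall>s\<in>{a..b}. AE x in lborel. V s x = v s x)"
proof (cases "a \<le> b")
  case ab: True
  define d where "d r s = (\<integral>x. \<bar>v r x - v s x\<bar> \<partial>lborel)" for r s
  have int: "integrable lborel (v s)" if "s \<in> {a..b}" for s
    using v that unfolding continuous_into_L1_def by blast
  have d_tendsto: "((\<lambda>r. d r s) \<longlongrightarrow> 0) (at s within {a..b})" if "s \<in> {a..b}" for s
    using v that unfolding continuous_into_L1_def d_def by blast
  have d_commute: "d r s = d s r" for r s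
    unfolding d_def by (simp add: abs_minus_commute)
  have d_nonneg: "d r s \<ge> 0" for r s unfolding d_def by simp
  have d_triangle: "d r t \<le> d r s + d s t" if "r \<in> {a..b}" "s \<in> {a..b}" "t \<in> {a..b}" for r s t
  proof -
    have "d r t \<le> (\<integral>x. \<bar>v r x - v s x\<bar> + \<bar>v s x - v t x\<bar> \<partial>lborel)"
      unfolding d_def using that int by (intro integral_mono) auto
    also have "\<dots> = d r s + d s t"
      unfolding d_def using that int by (intro Bochner_Integration.integral_add) auto
    finally show ?thesis .
  qed
  have d_cont: "continuous_on {a..b} (d r)" if r: "r \<in> {a..b}" for r
    unfolding continuous_on_def
  proof
    fix s assume s: "s \<in> {a..b}"
    have "((\<lambda>t. d r t - d r s) \<longlongrightarrow> 0) (at s within {a..b})"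
    proof (rule Lim_null_comparison[OF _ d_tendsto[OF s]])
      show "\<forall>\<^sub>F t in at s within {a..b}. norm (d r t - d r s) \<le> d t s"
        unfolding eventually_at_filter
        using d_triangle[OF r s] d_triangle[OF r _ s] d_commute
        by (intro always_eventually) (smt (verit) real_norm_def)
    qed
    then show "(d r \<longlongrightarrow> d r s) (at s within {a..b})" by (simp add: LIM_zero_iff)
  qed
  \<comment> \<open>Clamping the time makes all the functions below total on the line.\<close>
  define c where "c r = max a (min b r)" for r :: real
  have c: "c r \<in> {a..b}" for r using ab by (auto simp: c_def)
  have [measurable]: "c \<in> borel_measurable borel" unfolding c_def by measurable
  obtain D where D: "countable D" "D \<subseteq> {a..b}" "{a..b} \<subseteq> closure D"
    by (rule separable)
  have D_ne: "D \<noteq> {}" using D(3) ab by auto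
  define e where "e = from_nat_into D"
  have e: "e i \<in> {a..b}" for i using D(2) D_ne from_nat_into[of D i] by (auto simp: e_def)
  have dense: "\<exists>i. d (e i) s < \<epsilon>" if s: "s \<in> {a..b}" and "\<epsilon> > 0" for s \<epsilon>
  proof -
    have "\<forall>\<^sub>F r in at s within {a..b}. d r s < \<epsilon>"
      using d_tendsto[OF s] \<open>\<epsilon> > 0\<close> by (rule order_tendstoD(2))
    then obtain \<delta> where \<delta>: "\<delta> > 0" "\<And>r. r \<in> {a..b} \<Longrightarrow> r \<noteq> s \<Longrightarrow> dist r s < \<delta> \<Longrightarrow> d r s < \<epsilon>"
      unfolding eventually_at by auto
    obtain r where r: "r \<in> D" "dist r s < \<delta>"
      using D(3) s \<delta>(1) by (meson closure_approachable subsetD)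
    have "d s s = 0" by (simp add: d_def)
    then have "d r s < \<epsilon>" using \<delta>(2)[of r] r D(2) \<open>\<epsilon> > 0\<close> by (cases "r = s") auto
    moreover obtain i where "e i = r" using r(1) D(1) unfolding e_def by (metis from_nat_into_surj)
    ultimately show ?thesis by auto
  qed
  \<comment> \<open>The least index is a measurable choice, because the distances depend continuously on the time.\<close>
  define j where "j k r = (LEAST i. d (e i) (c r) < (1/2)^k)" for k :: nat and r
  have dj: "d (e (j k r)) (c r) < (1/2)^k" for k r
    unfolding j_def by (rule LeastI_ex) (intro dense c, simp)
  have d_meas: "(\<lambda>r. d (e i) (c r)) \<in> borel_measurable borel" for i
  proof -
    have "continuous_on UNIV c" unfolding c_def by (intro continuous_intros)
    then have "continuous_on UNIV (d (e i) \<circ> c)"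
      by (rule continuous_on_compose) (rule continuous_on_subset[OF d_cont[OF e]], use c in auto)
    then show ?thesis by (simp add: o_def borel_measurable_continuous_onI)
  qed
  have j [measurable]: "j k \<in> borel \<rightarrow>\<^sub>M count_space UNIV" for k
  proof -
    note d_meas [measurable]
    show ?thesis unfolding j_def by measurable
  qed
  define V where "V r x = lim (\<lambda>k. v (e (j k r)) x)" for r x
  have meas: "case_prod V \<in> borel_measurable (borel \<Otimes>\<^sub>M borel)"
  proof -
    have [measurable]: "v (e i) \<in> borel_measurable borel" for i
      using int[OF e] by auto
    have "(\<lambda>p. v (e (j k (fst p))) (snd p)) \<in> borel_measurable (borel \<Otimes>\<^sub>M borel)" for k
      by (rule measurable_compose_countable[where f="\<lambda>i p. v (e i) (snd p)"]) measurable
    then show ?thesis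
      unfolding V_def case_prod_beta by (rule borel_measurable_lim_metric)
  qed
  moreover have "AE x in lborel. V s x = v s x" if s: "s \<in> {a..b}" for s
  proof -
    have cs: "c s = s" using s by (auto simp: c_def)
    let ?f = "\<lambda>k x. v (e (j k s)) x - v s x"
    have f_int: "integrable lborel (?f k)" for k using int e s by auto
    have "(\<integral>\<^sup>+x. (\<Sum>k. ennreal \<bar>?f k x\<bar>) \<partial>lborel) = (\<Sum>k. \<integral>\<^sup>+x. ennreal \<bar>?f k x\<bar> \<partial>lborel)"
      using f_int by (intro nn_integral_suminf) auto
    also have "\<dots> \<le> (\<Sum>k. ennreal ((1/2)^k))"
    proof (intro suminf_le)
      fix k
      have "(\<integral>\<^sup>+x. ennreal \<bar>?f k x\<bar> \<partial>lborel) = ennreal (d (e (j k s)) s)"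
        unfolding d_def using f_int by (intro nn_integral_eq_integral) auto
      also have "\<dots> \<le> ennreal ((1/2)^k)" using dj[of k s] cs by (intro ennreal_leI) auto
      finally show "(\<integral>\<^sup>+x. ennreal \<bar>?f k x\<bar> \<partial>lborel) \<le> ennreal ((1/2)^k)" .
    qed auto
    also have "\<dots> = ennreal (\<Sum>k. (1/2)^k)"
      by (intro suminf_ennreal2) (auto intro: summable_geometric)
    also have "\<dots> < \<infinity>" by simp
    finally have "AE x in lborel. (\<Sum>k. ennreal \<bar>?f k x\<bar>) \<noteq> \<infinity>"
      using f_int by (intro nn_integral_PInf_AE) auto
    then show ?thesis
    proof eventually_elim
      case (elim x)
      have "summable (\<lambda>k. \<bar>?f k x\<bar>)"
        using elim by (intro summable_suminf_not_top) (auto simp: top_ennreal.rep_eq infinity_ennreal_def)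
      then have "(\<lambda>k. \<bar>?f k x\<bar>) \<longlonglongrightarrow> 0" by (rule summable_LIMSEQ_zero)
      then have "(\<lambda>k. v (e (j k s)) x) \<longlonglongrightarrow> v s x"
        by (simp add: tendsto_rabs_zero_iff LIM_zero_iff)
      then show "V s x = v s x" unfolding V_def by (rule limI)
    qed
  qed
  ultimately show ?thesis by blast
qed (auto intro!: exI[of _ "\<lambda>_ _. 0"])

section \<open>Solutions given by the formula of Duhamel\<close>

lemma delayed_birth_nonneg:
  assumes "\<And>z. k0 z \<ge> 0" "\<And>v. v \<ge> 0 \<Longrightarrow> g v \<ge> 0" "\<And>y. u (t - h) y \<ge> 0"
  shows "delayed_birth h k0 g u t x \<ge> 0"
  unfolding delayed_birth_def by (intro integral_nonneg_AE AE_I2 mult_nonneg_nonneg assms)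

lemma duhamel_solution_nonneg:
  assumes h: "h > 0" and k0: "\<And>z. k0 z \<ge> 0" and g: "\<And>v. v \<ge> 0 \<Longrightarrow> g v \<ge> 0"
    and u0: "\<And>s x. s \<in> {-h..0} \<Longrightarrow> u0 s x \<ge> 0"
    and u: "duhamel_solution h k0 g u0 u" and t: "- h \<le> t"
  shows "u t x \<ge> 0"
proof -
  have "\<forall>t x. - h \<le> t \<and> t \<le> real n * h \<longrightarrow> u t x \<ge> 0" for n
  proof (induction n)
    case 0
    then show ?case using u u0 unfolding duhamel_solution_def by auto
  next
    case (Suc n)
    show ?case
    proof (intro allI impI)
      fix t x assume t: "- h \<le> t \<and> t \<le> real (Suc n) * h"
      show "u t x \<ge> 0"
      proof (cases "t \<le> real n * h")
        case True
        then show ?thesis using Suc.IH t by blast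
      next
        case False
        have "0 \<le> real n * h" using h by simp
        have "real (Suc n) * h = real n * h + h" by (simp add: algebra_simps)
        then have "- h \<le> s - h \<and> s - h \<le> real n * h" if "s \<in> {real n * h..t}" for s
          using that t \<open>0 \<le> real n * h\<close> unfolding atLeastAtMost_iff by linarith
        then have "0 \<le> delayed_birth h k0 g u s y" if "s \<in> {real n * h..t}" for s y
          using Suc.IH that by (intro delayed_birth_nonneg k0 g) blast+
        then have "0 \<le> (LBINT s:{real n * h..t}. exp (- (t - s)) *
            (\<integral>y. heat_kernel (t - s) (x - y) * delayed_birth h k0 g u s y \<partial>lborel))"
          unfolding set_lebesgue_integral_def
          by (intro integral_nonneg_AE AE_I2)
             (auto simp: indicator_def intro!: mult_nonneg_nonneg integral_nonneg_AE AE_I2 heat_kernel_nonneg)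
        moreover have "0 \<le> exp (- (t - real n * h)) *
            (\<integral>y. heat_kernel (t - real n * h) (x - y) * u (real n * h) y \<partial>lborel)"
        proof -
          have "u (real n * h) y \<ge> 0" for y
            using Suc.IH h by (metis \<open>0 \<le> real n * h\<close> le_minus_iff minus_le_iff
              dual_order.trans less_imp_le neg_le_0_iff_le order_refl)
          then show ?thesis using False
            by (intro mult_nonneg_nonneg integral_nonneg_AE AE_I2 heat_kernel_nonneg) auto
        qed
        moreover have "u t x = exp (- (t - real n * h)) *
            (\<integral>y. heat_kernel (t - real n * h) (x - y) * u (real n * h) y \<partial>lborel) +
          (LBINT s:{real n * h..t}. exp (- (t - s)) *
            (\<integral>y. heat_kernel (t - s) (x - y) * delayed_birth h k0 g u s y \<partial>lborel))"
          using u False t unfolding duhamel_solution_def not_le by blast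
        ultimately show ?thesis by linarith
      qed
    qed
  qed
  moreover obtain n where "t \<le> real n * h"
    using h by (metis reals_Archimedean3 less_imp_le)
  ultimately show ?thesis using t by blast
qed

lemma AE_lborel_reflect:
  assumes "AE x in lborel. P x"
  shows "AE y in lborel. P ((x::real) - y)"
proof -
  from assms obtain N where N: "{x. \<not> P x} \<subseteq> N" "N \<in> null_sets lborel"
    by (auto elim!: AE_E simp: null_sets_def)
  have [measurable]: "N \<in> sets borel" using N(2) by auto
  have "AE y in lborel. x + (- 1) * y \<notin> N"
    by (rule AE_borel_affine[where P="\<lambda>y. y \<notin> N"]) (use AE_not_in[OF N(2)] in \<open>simp_all\<close>)
  then show ?thesis by (rule eventually_mono) (use N(1) in auto)
qed

text \<open>
  The birth function is arbitrary on the negative half-line, so that \<open>g\<close> itself can fail to be Borel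
  measurable; on nonnegative solutions it agrees with the function given here.
\<close>

lemma measurable_comp_nonneg_part:
  fixes g :: "real \<Rightarrow> real"
  assumes "continuous_on {0..} g"
  shows "(\<lambda>v. g (max 0 v)) \<in> borel_measurable borel"
proof -
  have "continuous_on UNIV (g \<circ> max 0)"
    by (rule continuous_on_compose) (auto intro!: continuous_intros continuous_on_subset[OF assms])
  then show ?thesis by (simp add: o_def borel_measurable_continuous_onI)
qed

text \<open>
  The initial data enter the solution at positive times only through space integrals. They may
  therefore be replaced by a version of them, with no change at positive times.
\<close>

lemma duhamel_solution_cong_AE:
  assumes h: "h > 0" and g: "continuous_on {0..} g" and [measurable]: "k0 \<in> borel_measurable borel"
    and u: "duhamel_solution h k0 g u0 u"
    and u0: "\<And>s x. s \<in> {-h..0} \<Longrightarrow> u0 s x \<ge> 0" and v0: "\<And>s x. s \<in> {-h..0} \<Longrightarrow> v0 s x \<ge> 0"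
    and u0_meas: "\<And>s. s \<in> {-h..0} \<Longrightarrow> u0 s \<in> borel_measurable borel"
    and v0_meas: "\<And>s. s \<in> {-h..0} \<Longrightarrow> v0 s \<in> borel_measurable borel"
    and eq: "\<And>s. s \<in> {-h..0} \<Longrightarrow> AE x in lborel. v0 s x = u0 s x"
  shows "duhamel_solution h k0 g v0 (\<lambda>t x. if t \<le> 0 then v0 t x else u t x)"
proof -
  define v where "v t x = (if t \<le> 0 then v0 t x else u t x)" for t x
  note [measurable] = measurable_comp_nonneg_part[OF g]
  have u_init: "u s = u0 s" if "s \<in> {-h..0}" for s
    using u that unfolding duhamel_solution_def by auto
  have birth: "delayed_birth h k0 g u s x = delayed_birth h k0 g v s x" if "s \<ge> 0" for s x
  proof (cases "s - h \<le> 0")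
    case True
    then have s: "s - h \<in> {-h..0}" using that by simp
    note [measurable] = u0_meas[OF s] v0_meas[OF s]
    have "AE y in lborel. v0 (s - h) (x - y) = u0 (s - h) (x - y)"
      by (rule AE_lborel_reflect[OF eq[OF s]])
    then have "(\<integral>y. k0 y * g (max 0 (u0 (s - h) (x - y))) \<partial>lborel) = (\<integral>y. k0 y * g (max 0 (v0 (s - h) (x - y))) \<partial>lborel)"
      by (intro integral_cong_AE) (measurable, auto elim: eventually_mono)
    then show ?thesis
      using True unfolding delayed_birth_def v_def by (simp add: u_init[OF s] u0[OF s] v0[OF s])
  next
    case False
    then show ?thesis unfolding delayed_birth_def v_def by simp
  qed
  have start: "(\<integral>y. heat_kernel \<tau> (x - y) * u (real n * h) y \<partial>lborel)
      = (\<integral>y. heat_kernel \<tau> (x - y) * v (real n * h) y \<partial>lborel)" for n \<tau> x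
  proof (cases "n = 0")
    case True
    have 0: "0 \<in> {-h..0}" using h by simp
    note [measurable] = u0_meas[OF 0] v0_meas[OF 0]
    have "(\<integral>y. heat_kernel \<tau> (x - y) * u0 0 y \<partial>lborel) = (\<integral>y. heat_kernel \<tau> (x - y) * v0 0 y \<partial>lborel)"
      using eq[OF 0] by (intro integral_cong_AE) (measurable, auto elim: eventually_mono)
    then show ?thesis using True by (simp add: v_def u_init[OF 0])
  next
    case False
    then have "real n * h > 0" using h by simp
    then show ?thesis by (simp add: v_def)
  qed
  have "duhamel_solution h k0 g v0 v"
    unfolding duhamel_solution_def
  proof (intro conjI ballI allI impI)
    show "v s x = v0 s x" if "s \<in> {-h..0}" for s x using that by (simp add: v_def)
    fix n :: nat and t x assume t: "real n * h < t \<and> t \<le> real (Suc n) * h"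
    have n: "real n * h \<ge> 0" using h by simp
    have "(LBINT s:{real n * h..t}. exp (- (t - s)) *
            (\<integral>y. heat_kernel (t - s) (x - y) * delayed_birth h k0 g u s y \<partial>lborel))
       = (LBINT s:{real n * h..t}. exp (- (t - s)) *
            (\<integral>y. heat_kernel (t - s) (x - y) * delayed_birth h k0 g v s y \<partial>lborel))"
      using n by (intro set_lebesgue_integral_cong) (auto simp: birth)
    moreover have "v t x = u t x" using t n by (simp add: v_def)
    ultimately show "v t x = exp (- (t - real n * h)) *
            (\<integral>y. heat_kernel (t - real n * h) (x - y) * v (real n * h) y \<partial>lborel) +
          (LBINT s:{real n * h..t}. exp (- (t - s)) *
            (\<integral>y. heat_kernel (t - s) (x - y) * delayed_birth h k0 g v s y \<partial>lborel))"
      using u t unfolding duhamel_solution_def by (simp add: start)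
  qed
  then show ?thesis unfolding v_def .
qed

lemma duhamel_solution_measurable:
  assumes h: "h > 0" and g: "continuous_on {0..} g" and [measurable]: "k0 \<in> borel_measurable borel"
    and u: "duhamel_solution h k0 g u0 u"
    and nonneg: "\<And>t x. - h \<le> t \<Longrightarrow> u t x \<ge> 0"
    and past: "\<And>t x. t \<le> 0 \<Longrightarrow> u t x = u0 t x"
    and [measurable]: "case_prod u0 \<in> borel_measurable (borel \<Otimes>\<^sub>M borel)"
  shows "case_prod u \<in> borel_measurable (borel \<Otimes>\<^sub>M borel)"
proof -
  note [measurable] = measurable_comp_nonneg_part[OF g]
  define v where "v n p = (if fst p \<le> real n * h then u (fst p) (snd p) else 0)" for n :: nat and p
  have v: "v n \<in> borel_measurable (borel \<Otimes>\<^sub>M borel)" for n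
  proof (induction n)
    case 0
    have "v 0 = (\<lambda>p. if fst p \<le> 0 then case_prod u0 p else 0)"
      by (auto simp: v_def past fun_eq_iff)
    then show ?case by simp
  next
    case (Suc n)
    note [measurable] = Suc
    define a where "a = real n * h"
    have a: "a \<ge> 0" using h by (simp add: a_def)
    \<comment> \<open>F is the right-hand side of the formula of Duhamel, with the solution up to time a as its only input.\<close>
    define F where "F p = exp (- (fst p - a)) *
            (\<integral>y. heat_kernel (fst p - a) (snd p - y) * v n (a, y) \<partial>lborel) +
          (\<integral>s. (if a \<le> s \<and> s \<le> fst p then exp (- (fst p - s)) *
            (\<integral>y. heat_kernel (fst p - s) (snd p - y) *
               (\<integral>z. k0 z * g (max 0 (v n (s - h, y - z))) \<partial>lborel) \<partial>lborel) else 0) \<partial>lborel)" for p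
    have F: "F \<in> borel_measurable (borel \<Otimes>\<^sub>M borel)"
      unfolding F_def by measurable
    have "v (Suc n) p = (if fst p \<le> a then v n p else if fst p \<le> real (Suc n) * h then F p else 0)" for p
    proof -
      consider "fst p \<le> a" | "a < fst p" "fst p \<le> real (Suc n) * h" | "real (Suc n) * h < fst p"
        by linarith
      then show ?thesis
      proof cases
        case 1
        moreover have "a \<le> real (Suc n) * h" using h by (simp add: a_def)
        ultimately show ?thesis by (simp add: v_def a_def)
      next
        case 2
        have "delayed_birth h k0 g u s y = (\<integral>z. k0 z * g (max 0 (v n (s - h, y - z))) \<partial>lborel)"
          if "a \<le> s" "s \<le> fst p" for s y
        proof -
          have "s - h \<le> real n * h" "- h \<le> s - h"
            using that 2 a by (auto simp: algebra_simps)
          then show ?thesis unfolding delayed_birth_def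
            by (intro Bochner_Integration.integral_cong) (auto simp: v_def nonneg)
        qed
        then have "(LBINT s:{a..fst p}. exp (- (fst p - s)) *
            (\<integral>y. heat_kernel (fst p - s) (snd p - y) * delayed_birth h k0 g u s y \<partial>lborel))
          = (\<integral>s. (if a \<le> s \<and> s \<le> fst p then exp (- (fst p - s)) *
            (\<integral>y. heat_kernel (fst p - s) (snd p - y) *
               (\<integral>z. k0 z * g (max 0 (v n (s - h, y - z))) \<partial>lborel) \<partial>lborel) else 0) \<partial>lborel)"
          unfolding set_lebesgue_integral_def
          by (intro Bochner_Integration.integral_cong) (auto simp: indicator_def)
        moreover have "v n (a, y) = u a y" for y by (simp add: v_def a_def)
        ultimately have "u (fst p) (snd p) = F p"
          using u 2 unfolding duhamel_solution_def F_def by (simp add: a_def)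
        then show ?thesis using 2 by (simp add: v_def)
      next
        case 3
        moreover have "a \<le> real (Suc n) * h" using h by (simp add: a_def)
        ultimately show ?thesis by (simp add: v_def)
      qed
    qed
    then have "v (Suc n) = (\<lambda>p. if fst p \<le> a then v n p else if fst p \<le> real (Suc n) * h then F p else 0)"
      by (simp add: fun_eq_iff)
    moreover note [measurable] = F
    ultimately show ?case by simp
  qed
  have "(\<lambda>n. v n p) \<longlonglongrightarrow> case_prod u p" for p
  proof -
    obtain N where N: "fst p \<le> real N * h"
      using h by (metis reals_Archimedean3 less_imp_le)
    have "v n p = case_prod u p" if "N \<le> n" for n
    proof -
      have "real N * h \<le> real n * h" using that h by (intro mult_right_mono) auto
      then show ?thesis using N by (simp add: v_def case_prod_beta)
    qed
    then show ?thesis by (intro tendsto_eventually) (auto simp: eventually_sequentially)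
  qed
  then show ?thesis by (intro borel_measurable_LIMSEQ_metric[OF v])
qed

section \<open>The exponentially weighted problem\<close>

text \<open>
  By convention a function that is not integrable, be it for lack of measurability, has integral 0.
\<close>

lemma ennreal_integral_le_nn_integral:
  assumes "\<And>x. f x \<ge> 0"
  shows "ennreal (\<integral>x. f x \<partial>M) \<le> (\<integral>\<^sup>+x. ennreal (f x) \<partial>M)"
proof (cases "integrable M f")
  case True
  then show ?thesis using assms by (simp add: nn_integral_eq_integral)
qed (simp add: not_integrable_integral_eq)

text \<open>
  Completing the square. The weight travels with the wave speed \<open>c\<close>; together with the decay \<open>exp (- s)\<close>
  it produces exactly the rate \<open>f1 c l = 1 + c l - l\<^sup>2\<close>.
\<close>

lemma exp_weight_heat_kernel:
  assumes "s \<ge> 0"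
  shows "exp (- l * (x + c * t)) * (exp (- s) * heat_kernel s (x - y))
    = exp (- (f1 c l) * s) * heat_kernel s (x - y + 2 * l * s) * exp (- l * (y + c * (t - s)))"
proof (cases "s = 0")
  case False
  have "- l * (x + c * t) + (- s + - ((x - y)\<^sup>2) / (4 * s))
    = - (f1 c l) * s + (- ((x - y + 2 * l * s)\<^sup>2) / (4 * s) + - l * (y + c * (t - s)))"
    using False by (simp add: f1_def field_simps power2_eq_square)
  from arg_cong[OF this, of exp] show ?thesis
    unfolding heat_kernel_def exp_add by simp
qed (simp add: heat_kernel_def)

lemma weighted_heat_le:
  assumes s: "s \<ge> 0" and v: "\<And>y. v y \<ge> 0" and [measurable]: "w \<in> borel_measurable borel"
    and le: "\<And>y. ennreal (exp (- l * (y + c * (t - s))) * v y) \<le> w y"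
  shows "ennreal (exp (- l * (x + c * t)) * (exp (- s) * (\<integral>y. heat_kernel s (x - y) * v y \<partial>lborel)))
    \<le> ennreal (exp (- (f1 c l) * s)) * conv (drift_heat l s) w x"
proof -
  have "ennreal (exp (- l * (x + c * t)) * (exp (- s) * (\<integral>y. heat_kernel s (x - y) * v y \<partial>lborel)))
    = ennreal (\<integral>y. exp (- l * (x + c * t)) * (exp (- s) * heat_kernel s (x - y)) * v y \<partial>lborel)"
    by (simp add: mult.assoc)
  also have "\<dots> \<le> (\<integral>\<^sup>+y. ennreal (exp (- l * (x + c * t)) * (exp (- s) * heat_kernel s (x - y)) * v y) \<partial>lborel)"
    using s v by (intro ennreal_integral_le_nn_integral mult_nonneg_nonneg heat_kernel_nonneg) auto
  also have "\<dots> \<le> (\<integral>\<^sup>+y. ennreal (exp (- (f1 c l) * s)) * (drift_heat l s (x - y) * w y) \<partial>lborel)"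
  proof (intro nn_integral_mono)
    fix y
    have "ennreal (exp (- l * (x + c * t)) * (exp (- s) * heat_kernel s (x - y)) * v y)
      = ennreal (exp (- (f1 c l) * s)) * (drift_heat l s (x - y) * ennreal (exp (- l * (y + c * (t - s))) * v y))"
      unfolding exp_weight_heat_kernel[OF s] drift_heat_def
      using s v by (simp add: ennreal_mult heat_kernel_nonneg mult.assoc)
    also have "\<dots> \<le> ennreal (exp (- (f1 c l) * s)) * (drift_heat l s (x - y) * w y)"
      by (intro mult_left_mono le) auto
    finally show "ennreal (exp (- l * (x + c * t)) * (exp (- s) * heat_kernel s (x - y)) * v y) \<le> \<dots>" .
  qed
  also have "\<dots> = ennreal (exp (- (f1 c l) * s)) * conv (drift_heat l s) w x"
    unfolding conv_def by (intro nn_integral_cmult) measurable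
  finally show ?thesis .
qed

lemma f2_pos:
  assumes "p > 0" "\<And>z. k0 z \<ge> 0" "has_bochner_integral lborel k0 1"
    and "integrable lborel (\<lambda>y. k0 y * exp (- l * y))"
  shows "f2 h k0 p c l > 0"
proof -
  have k0: "integrable lborel k0" "integral\<^sup>L lborel k0 = 1"
    using assms(3) by (auto simp: has_bochner_integral_iff)
  have "(\<integral>y. k0 y * exp (- l * y) \<partial>lborel) \<noteq> 0"
  proof
    assume "(\<integral>y. k0 y * exp (- l * y) \<partial>lborel) = 0"
    then have "AE y in lborel. k0 y * exp (- l * y) = 0"
      using assms by (subst (asm) integral_nonneg_eq_0_iff_AE) auto
    then have "AE y in lborel. k0 y = 0" by (rule eventually_mono) simp
    then have "integral\<^sup>L lborel k0 = 0" by (rule integral_eq_zero_AE)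
    then show False using k0 by simp
  qed
  moreover have "(\<integral>y. k0 y * exp (- l * y) \<partial>lborel) \<ge> 0"
    using assms by (intro integral_nonneg_AE AE_I2) auto
  ultimately show ?thesis using assms(1) unfolding f2_def by (intro mult_pos_pos) auto
qed

text \<open>
  The dispersal kernel seen through the weight, divided by its total mass \<open>f2\<close> with the factors \<open>p\<close> from the
  linearization at 0 and \<open>exp (- l c h)\<close> from the way travelled by the wave during the delay.
\<close>

definition tilted_kernel ::
    "real \<Rightarrow> (real \<Rightarrow> real) \<Rightarrow> real \<Rightarrow> real \<Rightarrow> real \<Rightarrow> real \<Rightarrow> ennreal" where
  "tilted_kernel h k0 p c l z = ennreal (p * exp (- l * c * h) * (k0 z * exp (- l * z)) / f2 h k0 p c l)"

lemma measurable_tilted_kernel [measurable]: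
  assumes [measurable]: "k0 \<in> borel_measurable borel"
  shows "tilted_kernel h k0 p c l \<in> borel_measurable borel"
  unfolding tilted_kernel_def by measurable

lemma nn_integral_tilted_kernel:
  assumes "p \<ge> 0" "\<And>z. k0 z \<ge> 0" "integrable lborel (\<lambda>y. k0 y * exp (- l * y))"
    and "f2 h k0 p c l > 0"
  shows "(\<integral>\<^sup>+z. tilted_kernel h k0 p c l z \<partial>lborel) = 1"
proof -
  have "(\<integral>\<^sup>+z. tilted_kernel h k0 p c l z \<partial>lborel)
    = ennreal (\<integral>z. p * exp (- l * c * h) * (k0 z * exp (- l * z)) / f2 h k0 p c l \<partial>lborel)"
    unfolding tilted_kernel_def using assms by (intro nn_integral_eq_integral) auto
  also have "(\<integral>z. p * exp (- l * c * h) * (k0 z * exp (- l * z)) / f2 h k0 p c l \<partial>lborel)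
    = f2 h k0 p c l / f2 h k0 p c l"
  proof -
    have "(\<integral>z. A * (k0 z * exp (- l * z)) / F \<partial>lborel) = A * (\<integral>z. k0 z * exp (- l * z) \<partial>lborel) / F" for A F
      by simp
    then show ?thesis by (simp only: f2_def)
  qed
  also have "\<dots> = 1" using assms by simp
  finally show ?thesis by simp
qed

text \<open>
  The bound \<open>g v \<le> p v\<close> replaces the birth term by its linearization; the weight then turns \<open>k0\<close> into
  \<open>f2\<close> times the probability density \<open>tilted_kernel\<close>.
\<close>

lemma weighted_birth_le:
  assumes p: "p \<ge> 0" and k0: "\<And>z. k0 z \<ge> 0" and [measurable]: "k0 \<in> borel_measurable borel"
    and f2: "f2 h k0 p c l > 0"
    and g: "\<And>v. v \<ge> 0 \<Longrightarrow> 0 \<le> g v \<and> g v \<le> p * v"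
    and u: "\<And>y. u (s - h) y \<ge> 0"
    and [measurable]: "u (s - h) \<in> borel_measurable borel"
  shows "ennreal (exp (- l * (x + c * s)) * delayed_birth h k0 g u s x)
    \<le> ennreal (f2 h k0 p c l) * conv (tilted_kernel h k0 p c l)
        (\<lambda>y. ennreal (exp (- l * (y + c * (s - h))) * u (s - h) y)) x"
proof -
  let ?w = "\<lambda>y. ennreal (exp (- l * (y + c * (s - h))) * u (s - h) y)"
  have "ennreal (exp (- l * (x + c * s)) * delayed_birth h k0 g u s x)
    = ennreal (\<integral>y. exp (- l * (x + c * s)) * (k0 y * g (u (s - h) (x - y))) \<partial>lborel)"
    by (simp add: delayed_birth_def)
  also have "\<dots> \<le> (\<integral>\<^sup>+y. ennreal (exp (- l * (x + c * s)) * (k0 y * g (u (s - h) (x - y)))) \<partial>lborel)"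
    by (intro ennreal_integral_le_nn_integral mult_nonneg_nonneg k0 conjunct1[OF g] u exp_ge_zero)
  also have "\<dots> \<le> (\<integral>\<^sup>+y. ennreal (f2 h k0 p c l) * (tilted_kernel h k0 p c l y * ?w (x - y)) \<partial>lborel)"
  proof (rule nn_integral_mono)
    fix y
    have "exp (- l * (x + c * s)) * (k0 y * g (u (s - h) (x - y)))
      \<le> exp (- l * (x + c * s)) * (k0 y * (p * u (s - h) (x - y)))"
      by (intro mult_left_mono k0 conjunct2[OF g] u exp_ge_zero)
    also have "\<dots> = f2 h k0 p c l *
       ((p * exp (- l * c * h) * (k0 y * exp (- l * y)) / f2 h k0 p c l) *
        (exp (- l * (x - y + c * (s - h))) * u (s - h) (x - y)))"
    proof -
      have split: "exp (- l * (x + c * s)) = exp (- l * c * h) * exp (- l * y) * exp (- l * (x - y + c * (s - h)))"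
        unfolding exp_add[symmetric] by (rule arg_cong[of _ _ exp]) (simp add: algebra_simps)
      have "e1 * e2 * e3 * (k * (p * v)) = F * ((p * e1 * (k * e2) / F) * (e3 * v))"
        if "F > 0" for e1 e2 e3 k v F :: real
        using that by simp
      then show ?thesis unfolding split using f2 by blast
    qed
    finally have "ennreal (exp (- l * (x + c * s)) * (k0 y * g (u (s - h) (x - y)))) \<le> ennreal \<dots>"
      by (rule ennreal_leI)
    also have "\<dots> = ennreal (f2 h k0 p c l) * (tilted_kernel h k0 p c l y * ?w (x - y))"
      unfolding tilted_kernel_def using f2 k0 u p
      by (simp only: ennreal_mult mult_nonneg_nonneg divide_nonneg_nonneg exp_ge_zero less_imp_le)
    finally show "ennreal (exp (- l * (x + c * s)) * (k0 y * g (u (s - h) (x - y)))) \<le> \<dots>" .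
  qed
  also have "\<dots> = ennreal (f2 h k0 p c l) * (\<integral>\<^sup>+y. tilted_kernel h k0 p c l y * ?w (x - y) \<partial>lborel)"
    by (intro nn_integral_cmult) measurable
  also have "(\<integral>\<^sup>+y. tilted_kernel h k0 p c l y * ?w (x - y) \<partial>lborel) = conv (tilted_kernel h k0 p c l) ?w x"
    by (intro conv_swap) measurable
  finally show ?thesis .
qed

text \<open>
  The equation \<open>f1 = f2\<close> says that the weighted removal rate and the weighted birth rate coincide. This is
  what makes the weighted solution an instance of the abstract problem above.
\<close>

lemma weighted_duhamel_step:
  assumes h: "h > 0" and p: "p \<ge> 0" and k0: "\<And>z. k0 z \<ge> 0"
    and k0_meas [measurable]: "k0 \<in> borel_measurable borel"
    and f1: "f1 c l = f2 h k0 p c l" "f2 h k0 p c l > 0"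
    and g: "\<And>v. v \<ge> 0 \<Longrightarrow> 0 \<le> g v \<and> g v \<le> p * v"
    and u: "duhamel_solution h k0 g u0 u"
    and nonneg: "\<And>t x. - h \<le> t \<Longrightarrow> u t x \<ge> 0"
    and meas: "case_prod u \<in> borel_measurable (borel \<Otimes>\<^sub>M borel)"
    and t: "real n * h < t" "t \<le> real (Suc n) * h"
  defines "W \<equiv> \<lambda>t x. ennreal (exp (- l * (x + c * t)) * u t x)"
  shows "W t x \<le> ennreal (exp (- (f1 c l) * (t - real n * h))) * conv (drift_heat l (t - real n * h)) (W (real n * h)) x
        + (\<integral>\<^sup>+s. ennreal (f1 c l * exp (- (f1 c l) * (t - s))) * indicator {real n * h<..t} s *
             conv (drift_heat l (t - s)) (conv (tilted_kernel h k0 p c l) (W (s - h))) x \<partial>lborel)"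
proof -
  define a where "a = real n * h"
  have a: "a \<ge> 0" "a < t" using h t by (auto simp: a_def)
  let ?q = "f1 c l"
  let ?K = "tilted_kernel h k0 p c l"
  note [measurable (raw)] = measurable_joint_comp[OF meas]
  note [measurable] = measurable_slice[OF meas]
  have [measurable]: "W r \<in> borel_measurable borel" for r
    unfolding W_def by measurable
  let ?I = "\<lambda>s. exp (- (t - s)) * (\<integral>y. heat_kernel (t - s) (x - y) * delayed_birth h k0 g u s y \<partial>lborel)"
  let ?E = "exp (- l * (x + c * t))"
  have birth_nonneg: "delayed_birth h k0 g u s y \<ge> 0" if "a \<le> s" for s y
    using that a by (intro delayed_birth_nonneg k0 conjunct1[OF g] nonneg) auto
  have I_nonneg: "?I s \<ge> 0" if "a \<le> s" "s \<le> t" for s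
    using birth_nonneg[OF that(1)] that
    by (intro mult_nonneg_nonneg integral_nonneg_AE AE_I2 heat_kernel_nonneg) auto
  have source: "ennreal (?E * ?I s) \<le> ennreal (?q * exp (- ?q * (t - s))) * conv (drift_heat l (t - s)) (conv ?K (W (s - h))) x"
    if s: "a \<le> s" "s \<le> t" for s
  proof -
    have "ennreal (?E * ?I s) \<le> ennreal (exp (- ?q * (t - s))) *
        conv (drift_heat l (t - s)) (\<lambda>y. ennreal ?q * conv ?K (W (s - h)) y) x"
    proof (rule weighted_heat_le)
      fix y
      have "ennreal (exp (- l * (y + c * s)) * delayed_birth h k0 g u s y) \<le> ennreal ?q * conv ?K (W (s - h)) y"
        unfolding W_def f1(1) using s a nonneg by (intro weighted_birth_le p k0 f1 g) auto
      then show "ennreal (exp (- l * (y + c * (t - (t - s)))) * delayed_birth h k0 g u s y) \<le> ennreal ?q * conv ?K (W (s - h)) y"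
        by simp
    qed (use s birth_nonneg in auto)
    also have "\<dots> = ennreal (?q * exp (- ?q * (t - s))) * conv (drift_heat l (t - s)) (conv ?K (W (s - h))) x"
      using f1 by (subst conv_cmult) (auto simp: ennreal_mult' mult_ac)
    finally show ?thesis .
  qed
  have "(LBINT s:{a..t}. ?I s) \<ge> 0"
    unfolding set_lebesgue_integral_def using I_nonneg
    by (intro integral_nonneg_AE AE_I2) (auto simp: indicator_def)
  moreover have "(\<integral>y. heat_kernel (t - a) (x - y) * u a y \<partial>lborel) \<ge> 0"
    using a h nonneg by (intro integral_nonneg_AE AE_I2 mult_nonneg_nonneg heat_kernel_nonneg) auto
  moreover have "u t x = exp (- (t - a)) * (\<integral>y. heat_kernel (t - a) (x - y) * u a y \<partial>lborel) + (LBINT s:{a..t}. ?I s)"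
    using u t unfolding duhamel_solution_def a_def by blast
  ultimately have "W t x = ennreal (?E * (exp (- (t - a)) * (\<integral>y. heat_kernel (t - a) (x - y) * u a y \<partial>lborel)))
     + ennreal (?E * (LBINT s:{a..t}. ?I s))"
    unfolding W_def by (simp add: distrib_left ennreal_plus[symmetric] del: ennreal_plus)
  also have "\<dots> \<le> ennreal (exp (- ?q * (t - a))) * conv (drift_heat l (t - a)) (W a) x
     + (\<integral>\<^sup>+s. ennreal (?q * exp (- ?q * (t - s))) * indicator {a<..t} s *
             conv (drift_heat l (t - s)) (conv ?K (W (s - h))) x \<partial>lborel)"
  proof (intro add_mono)
    show "ennreal (?E * (exp (- (t - a)) * (\<integral>y. heat_kernel (t - a) (x - y) * u a y \<partial>lborel)))
      \<le> ennreal (exp (- ?q * (t - a))) * conv (drift_heat l (t - a)) (W a) x"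
      using a h nonneg by (intro weighted_heat_le) (auto simp: W_def)
    have "ennreal (?E * (LBINT s:{a..t}. ?I s)) = ennreal (\<integral>s. ?E * (indicator {a..t} s * ?I s) \<partial>lborel)"
      by (simp add: set_lebesgue_integral_def)
    also have "\<dots> \<le> (\<integral>\<^sup>+s. ennreal (?E * (indicator {a..t} s * ?I s)) \<partial>lborel)"
      using I_nonneg by (intro ennreal_integral_le_nn_integral) (auto simp: indicator_def)
    also have "\<dots> \<le> (\<integral>\<^sup>+s. ennreal (?q * exp (- ?q * (t - s))) * indicator {a<..t} s *
             conv (drift_heat l (t - s)) (conv ?K (W (s - h))) x \<partial>lborel)"
      using source by (intro nn_integral_mono_AE eventually_mono[OF AE_lborel_singleton[of a]])
        (auto simp: indicator_def)
    finally show "ennreal (?E * (LBINT s:{a..t}. ?I s)) \<le> \<dots>" .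
  qed
  finally show ?thesis unfolding a_def .
qed

text \<open>
  The abstract decay result requires the bound on the initial data at every point and joint
  measurability. Both are arranged by choosing a version of the data and cutting it off at its essential
  bound \<open>B exp (l x)\<close>.
\<close>

lemma weighted_solution_decays:
  assumes h: "h > 0" and p: "p \<ge> 0" and k0: "\<And>z. k0 z \<ge> 0"
    and k0_meas [measurable]: "k0 \<in> borel_measurable borel"
    and k0_exp: "integrable lborel (\<lambda>y. k0 y * exp (- l * y))"
    and f1: "f1 c l = f2 h k0 p c l" "f2 h k0 p c l > 0"
    and g: "\<And>v. v \<ge> 0 \<Longrightarrow> 0 \<le> g v \<and> g v \<le> p * v" and g_cont: "continuous_on {0..} g"
    and u0: "\<And>s x. s \<in> {-h..0} \<Longrightarrow> u0 s x \<ge> 0"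
    and u0_cont: "continuous_into_L1 {-h..0} u0"
    and bdd: "uniformly_bounded_L1_Linf {-h..0} (\<lambda>s x. exp (- l * x) * u0 s x)"
    and u: "duhamel_solution h k0 g u0 u"
    and \<epsilon>: "\<epsilon> > 0"
  shows "\<exists>T>0. \<forall>t\<ge>T. \<forall>x. exp (- l * (x + c * t)) * u t x \<le> \<epsilon>"
proof -
  obtain B where B: "\<And>s. s \<in> {-h..0} \<Longrightarrow> integrable lborel (\<lambda>x. exp (- l * x) * u0 s x)"
    "\<And>s. s \<in> {-h..0} \<Longrightarrow> (\<integral>x. \<bar>exp (- l * x) * u0 s x\<bar> \<partial>lborel) \<le> B"
    "\<And>s. s \<in> {-h..0} \<Longrightarrow> AE x in lborel. \<bar>exp (- l * x) * u0 s x\<bar> \<le> B"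
    using bdd unfolding uniformly_bounded_L1_Linf_def by blast
  have "B \<ge> 0"
  proof -
    have "0 \<le> (\<integral>x. \<bar>exp (- l * x) * u0 0 x\<bar> \<partial>lborel)" by (intro integral_nonneg_AE AE_I2) simp
    also have "\<dots> \<le> B" using h by (intro B(2)) simp
    finally show ?thesis .
  qed
  obtain V where V [measurable]: "case_prod V \<in> borel_measurable (borel \<Otimes>\<^sub>M borel)"
    and V_eq: "\<And>s. s \<in> {-h..0} \<Longrightarrow> AE x in lborel. V s x = u0 s x"
    using continuous_L1_jointly_measurable_version[OF u0_cont] by blast
  define v0 where "v0 s x = max 0 (min (B * exp (l * x)) (V s x))" for s x
  have v0_nonneg: "v0 s x \<ge> 0" for s x by (simp add: v0_def)
  have v0_le: "v0 s x \<le> B * exp (l * x)" for s x using \<open>B \<ge> 0\<close> by (simp add: v0_def)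
  note [measurable (raw)] = measurable_joint_comp[OF V]
  have v0_meas [measurable]: "case_prod v0 \<in> borel_measurable (borel \<Otimes>\<^sub>M borel)"
    unfolding v0_def by measurable
  have v0_eq: "AE x in lborel. v0 s x = u0 s x" if s: "s \<in> {-h..0}" for s
    using V_eq[OF s] B(3)[OF s]
  proof eventually_elim
    case (elim x)
    have "u0 s x = exp (l * x) * (exp (- l * x) * u0 s x)"
      by (simp add: exp_minus)
    also have "\<dots> \<le> exp (l * x) * B" using elim by (intro mult_left_mono) auto
    finally show ?case using elim u0[OF s, of x] by (simp add: v0_def mult.commute)
  qed
  define v where "v t x = (if t \<le> 0 then v0 t x else u t x)" for t x
  have u0_meas: "u0 s \<in> borel_measurable borel" if "s \<in> {-h..0}" for s
    by (rule continuous_into_L1_measurable[OF u0_cont that])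
  have v: "duhamel_solution h k0 g v0 v"
    unfolding v_def using v0_nonneg v0_eq u0_meas
    by (intro duhamel_solution_cong_AE[OF h g_cont k0_meas u u0]) (auto simp: v0_def)
  have v_nonneg: "v t x \<ge> 0" if "- h \<le> t" for t x
    using g v0_nonneg that by (intro duhamel_solution_nonneg[OF h k0 _ _ v]) auto
  have v_meas: "case_prod v \<in> borel_measurable (borel \<Otimes>\<^sub>M borel)"
    by (rule duhamel_solution_measurable[OF h g_cont k0_meas v v_nonneg _ v0_meas]) (auto simp: v_def)
  note [measurable (raw)] = measurable_joint_comp[OF v_meas]
  define W where "W t x = ennreal (exp (- l * (x + c * t)) * v t x)" for t x
  define M where "M = B * exp (\<bar>l * c\<bar> * h)"
  have weight: "exp (- l * (x + c * t)) \<le> exp (\<bar>l * c\<bar> * h) * exp (- l * x)" if "- h \<le> t" "t \<le> 0" for t x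
  proof -
    have "- (l * c) * t \<le> \<bar>l * c\<bar> * \<bar>t\<bar>" by (metis abs_ge_self abs_minus abs_mult)
    also have "\<dots> \<le> \<bar>l * c\<bar> * h" using that by (intro mult_left_mono) auto
    finally show ?thesis by (simp add: exp_add[symmetric] algebra_simps)
  qed
  interpret delayed_subsolution h "f1 c l" l M "tilted_kernel h k0 p c l" W
  proof
    show "M \<ge> 0" using \<open>B \<ge> 0\<close> by (simp add: M_def)
    show "f1 c l > 0" using f1 by simp
    show "(\<integral>\<^sup>+z. tilted_kernel h k0 p c l z \<partial>lborel) \<le> 1"
      using nn_integral_tilted_kernel[OF p k0 k0_exp f1(2)] by simp
    show "case_prod W \<in> borel_measurable (borel \<Otimes>\<^sub>M borel)"
      unfolding W_def by measurable
    show "tilted_kernel h k0 p c l \<in> borel_measurable borel" by measurable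
    show "W t x \<le> ennreal (exp (- (f1 c l) * (t - real n * h))) * conv (drift_heat l (t - real n * h)) (W (real n * h)) x
        + (\<integral>\<^sup>+s. ennreal (f1 c l * exp (- (f1 c l) * (t - s))) * indicator {real n * h<..t} s *
             conv (drift_heat l (t - s)) (conv (tilted_kernel h k0 p c l) (W (s - h))) x \<partial>lborel)"
      if "real n * h < t" "t \<le> real (Suc n) * h" for n t x
      using weighted_duhamel_step[OF h p k0 k0_meas f1 g v v_nonneg v_meas that] unfolding W_def .
    fix t :: real assume t: "- h \<le> t" "t \<le> 0"
    have W_le: "W t x \<le> ennreal (exp (\<bar>l * c\<bar> * h) * (exp (- l * x) * v0 t x))" for x
      using mult_right_mono[OF weight[OF t] v0_nonneg] t
      unfolding W_def v_def by (intro ennreal_leI) (simp add: mult.assoc)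
    show "W t x \<le> ennreal M" for x
    proof -
      have "exp (- l * x) * v0 t x \<le> exp (- l * x) * (B * exp (l * x))"
        by (intro mult_left_mono v0_le) auto
      also have "\<dots> = B" by (simp add: exp_minus)
      finally have "exp (\<bar>l * c\<bar> * h) * (exp (- l * x) * v0 t x) \<le> exp (\<bar>l * c\<bar> * h) * B"
        by (intro mult_left_mono) auto
      then show ?thesis
        using order_trans[OF W_le ennreal_leI] by (simp add: M_def mult.commute)
    qed
    have ts: "t \<in> {-h..0}" using t by simp
    have "(\<integral>\<^sup>+x. W t x \<partial>lborel) \<le> (\<integral>\<^sup>+x. ennreal (exp (\<bar>l * c\<bar> * h) * (exp (- l * x) * v0 t x)) \<partial>lborel)"
      by (intro nn_integral_mono W_le)
    also have "\<dots> = (\<integral>\<^sup>+x. ennreal (exp (\<bar>l * c\<bar> * h)) * ennreal \<bar>exp (- l * x) * u0 t x\<bar> \<partial>lborel)"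
      using v0_eq[OF ts] u0[OF ts]
      by (intro nn_integral_cong_AE) (auto elim!: eventually_mono simp: ennreal_mult' abs_mult)
    also have "\<dots> = ennreal (exp (\<bar>l * c\<bar> * h)) * ennreal (\<integral>x. \<bar>exp (- l * x) * u0 t x\<bar> \<partial>lborel)"
      using B(1)[OF ts] by (subst nn_integral_cmult) (auto simp: nn_integral_eq_integral)
    also have "\<dots> \<le> ennreal (exp (\<bar>l * c\<bar> * h)) * ennreal B"
      by (intro mult_left_mono ennreal_leI B(2) ts) auto
    also have "\<dots> = ennreal M"
      using \<open>B \<ge> 0\<close> by (simp add: M_def ennreal_mult' mult.commute)
    finally show "(\<integral>\<^sup>+x. W t x \<partial>lborel) \<le> ennreal M" .
  qed fact+
  obtain T where T: "T \<ge> 0" "\<And>t x. t \<ge> T \<Longrightarrow> W t x \<le> ennreal \<epsilon>"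
    using uniform_decay[OF \<epsilon>] by blast
  show ?thesis
  proof (intro exI[of _ "T + 1"] conjI allI impI)
    fix t x assume t: "t \<ge> T + 1"
    then have "W t x = ennreal (exp (- l * (x + c * t)) * u t x)" using T(1) by (simp add: W_def v_def)
    moreover have "W t x \<le> ennreal \<epsilon>" using T(2) t by simp
    ultimately show "exp (- l * (x + c * t)) * u t x \<le> \<epsilon>" using \<epsilon> by simp
  qed (use T in auto)
qed

section \<open>Extinction ahead of the critical fronts\<close>

lemma SUP_ereal_tendsto_0:
  fixes u :: "real \<Rightarrow> real \<Rightarrow> real"
  assumes ne: "\<And>t. A t \<noteq> {}" and nonneg: "\<And>t z. t \<ge> 0 \<Longrightarrow> u t z \<ge> 0"
    and small: "\<And>\<epsilon>. \<epsilon> > 0 \<Longrightarrow> \<exists>T. \<forall>t\<ge>T. \<forall>z\<in>A t. u t z \<le> \<epsilon>"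
  shows "((\<lambda>t. SUP z\<in>A t. ereal (u t z)) \<longlongrightarrow> 0) at_top"
proof (rule order_tendstoI)
  fix a :: ereal assume "a < 0"
  have "0 \<le> (SUP z\<in>A t. ereal (u t z))" if "t \<ge> 0" for t
    using ne[of t] nonneg[OF that] by (auto intro: SUP_upper2)
  then show "\<forall>\<^sub>F t in at_top. a < (SUP z\<in>A t. ereal (u t z))"
    using \<open>a < 0\<close> by (intro eventually_mono[OF eventually_ge_at_top[of 0]]) (rule less_le_trans)
next
  fix a :: ereal assume "0 < a"
  then obtain \<epsilon> where \<epsilon>: "0 < ereal \<epsilon>" "ereal \<epsilon> < a" using ereal_dense2 by blast
  then obtain T where "\<forall>t\<ge>T. \<forall>z\<in>A t. u t z \<le> \<epsilon>" using small[of \<epsilon>] by auto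
  then have "(SUP z\<in>A t. ereal (u t z)) \<le> ereal \<epsilon>" if "t \<ge> T" for t
    using that by (intro SUP_least) auto
  then show "\<forall>\<^sub>F t in at_top. (SUP z\<in>A t. ereal (u t z)) < a"
    using \<epsilon>(2) by (intro eventually_mono[OF eventually_ge_at_top[of T]]) (rule le_less_trans)
qed

lemma uniformly_bounded_L1_Linf_weighted:
  fixes u0 :: "real \<Rightarrow> real \<Rightarrow> real"
  assumes meas: "\<And>s. s \<in> I \<Longrightarrow> u0 s \<in> borel_measurable borel"
    and bdd: "\<And>s x. s \<in> I \<Longrightarrow> \<bar>u0 s x\<bar> \<le> B"
    and supp: "\<And>s x. s \<in> I \<Longrightarrow> u0 s x \<noteq> 0 \<Longrightarrow> \<bar>x\<bar> \<le> R"
    and B: "B \<ge> 0" and R: "R \<ge> 0"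
  shows "uniformly_bounded_L1_Linf I (\<lambda>s x. exp (- l * x) * u0 s x)"
proof -
  define C where "C = exp (\<bar>l\<bar> * R) * B"
  have C: "C \<ge> 0" using B by (simp add: C_def)
  have le: "\<bar>exp (- l * x) * u0 s x\<bar> \<le> C * indicator {-R..R} x" if s: "s \<in> I" for s x
  proof (cases "u0 s x = 0")
    case False
    then have x: "\<bar>x\<bar> \<le> R" using supp s by blast
    have "- l * x \<le> \<bar>l\<bar> * \<bar>x\<bar>" by (metis abs_ge_self abs_minus abs_mult)
    also have "\<dots> \<le> \<bar>l\<bar> * R" using x by (intro mult_left_mono) auto
    finally have "\<bar>exp (- l * x) * u0 s x\<bar> \<le> C"
      unfolding C_def abs_mult using bdd[OF s] by (intro mult_mono) auto
    then show ?thesis using x by (simp add: indicator_def abs_le_iff)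
  qed (use C in auto)
  have maj: "integrable lborel (\<lambda>x. C * indicator {-R..R} x)"
    using R by (intro integrable_mult_right integrable_real_indicator) (auto simp: emeasure_lborel_Icc)
  have int: "integrable lborel (\<lambda>x. exp (- l * x) * u0 s x)" if s: "s \<in> I" for s
  proof (rule Bochner_Integration.integrable_bound[OF maj])
    show "(\<lambda>x. exp (- l * x) * u0 s x) \<in> borel_measurable lborel"
      using meas[OF s] by measurable
    show "AE x in lborel. norm (exp (- l * x) * u0 s x) \<le> norm (C * indicator {-R..R} x)"
      using le[OF s] C by (intro AE_I2) (simp add: indicator_def split: if_splits)
  qed
  have "(\<integral>x. \<bar>exp (- l * x) * u0 s x\<bar> \<partial>lborel) \<le> C * (2 * R)" if s: "s \<in> I" for s
  proof -
    have "(\<integral>x. \<bar>exp (- l * x) * u0 s x\<bar> \<partial>lborel) \<le> (\<integral>x. C * indicator {-R..R} x \<partial>lborel)"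
      using int[OF s] maj le[OF s] by (intro integral_mono) auto
    also have "\<dots> = C * (2 * R)" using R by simp
    finally show ?thesis .
  qed
  moreover have "\<bar>exp (- l * x) * u0 s x\<bar> \<le> C" if s: "s \<in> I" for s x
    using C by (intro order_trans[OF le[OF s]]) (simp add: indicator_def)
  ultimately show ?thesis
    unfolding uniformly_bounded_L1_Linf_def using int
    by (intro exI[of _ "max (C * (2 * R)) C"] ballI conjI AE_I2) (simp_all add: le_max_iff_disj)
qed

theorem theorem3p6:
  fixes h \<kappa> a b cm cp \<mu>m \<mu>p :: real
    and g g' k0 :: "real \<Rightarrow> real"
    and u0 u :: "real \<Rightarrow> real \<Rightarrow> real"
  assumes "h > 0"
    and "condition_M g g' \<kappa>"
    and "condition_K0 k0 a b"
    and "critical_speeds h k0 g cm cp"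
    and "\<mu>m < 0" and "tangency_point h k0 (g' 0) cm \<mu>m"
    and "0 < \<mu>p" and "tangency_point h k0 (g' 0) cp \<mu>p"
    and "\<forall>s\<in>{-h..0}. \<forall>x. u0 s x \<ge> 0"
    and "continuous_into_L1 {-h..0} u0"
    and "duhamel_solution h k0 g u0 u"
  shows "(uniformly_bounded_L1_Linf {-h..0} (\<lambda>s x. exp (- \<mu>p * x) * u0 s x) \<longrightarrow>
            (\<forall>c\<ge>cp. ((\<lambda>t. SUP z\<in>{..- c * t}. ereal (u t z)) \<longlongrightarrow> 0) at_top))
       \<and> (uniformly_bounded_L1_Linf {-h..0} (\<lambda>s x. exp (- \<mu>m * x) * u0 s x) \<longrightarrow>
            (\<forall>c\<le>cm. ((\<lambda>t. SUP z\<in>{- c * t..}. ereal (u t z)) \<longlongrightarrow> 0) at_top))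
       \<and> (cp * cm > 0 \<and>
          bounded ((\<lambda>(s, x). u0 s x) ` ({-h..0} \<times> UNIV)) \<and>
          compact (closure {(s, x). s \<in> {-h..0} \<and> u0 s x \<noteq> 0}) \<longrightarrow>
            (\<forall>z. ((\<lambda>t. u t z) \<longlongrightarrow> 0) at_top))"
proof -
  have h: "h > 0" by fact
  have p: "g' 0 > 0" and g: "\<And>v. v \<ge> 0 \<Longrightarrow> 0 \<le> g v \<and> g v \<le> g' 0 * v"
    and g_cont: "continuous_on {0..} g"
    using assms(2) unfolding condition_M_def by (auto dest: lipschitz_on_continuous_on)
  have k0: "\<And>z. k0 z \<ge> 0" and k0_int: "has_bochner_integral lborel k0 1"
    using assms(3) unfolding condition_K0_def by auto
  have k0_meas: "k0 \<in> borel_measurable borel"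
    using has_bochner_integral_integrable k0_int by (auto simp: has_bochner_integral_iff)
  have u0: "\<And>s x. s \<in> {-h..0} \<Longrightarrow> u0 s x \<ge> 0" using assms(9) by blast
  have nonneg: "u t z \<ge> 0" if "t \<ge> 0" for t z
    by (rule duhamel_solution_nonneg[OF h k0 conjunct1[OF g] u0 assms(11)]) (use that h in auto)
  \<comment> \<open>On the half-line where l (z + c t) \<le> 0 the weight is at least 1. The sign of l decides which half-line this is, so both parts are covered at once.\<close>
  have decay: "\<exists>T>0. \<forall>t\<ge>T. \<forall>z. l * (z + c * t) \<le> 0 \<longrightarrow> u t z \<le> \<epsilon>"
    if tangent: "tangency_point h k0 (g' 0) c l"
      and bdd: "uniformly_bounded_L1_Linf {-h..0} (\<lambda>s x. exp (- l * x) * u0 s x)" and \<epsilon>: "\<epsilon> > 0"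
    for c l \<epsilon>
  proof -
    have int: "integrable lborel (\<lambda>y. k0 y * exp (- l * y))" and f: "f1 c l = f2 h k0 (g' 0) c l"
      using tangent interior_subset unfolding tangency_point_def by auto
    have "f2 h k0 (g' 0) c l > 0" by (rule f2_pos[OF p k0 k0_int int])
    then obtain T where T: "T > 0" "\<And>t x. t \<ge> T \<Longrightarrow> exp (- l * (x + c * t)) * u t x \<le> \<epsilon>"
      using weighted_solution_decays[OF h less_imp_le[OF p] k0 k0_meas int f _ g g_cont u0 assms(10) bdd assms(11) \<epsilon>]
      by blast
    have "u t z \<le> \<epsilon>" if "t \<ge> T" "l * (z + c * t) \<le> 0" for t z
    proof -
      have "1 * u t z \<le> exp (- l * (z + c * t)) * u t z"
        using that T(1) nonneg[of t z] by (intro mult_right_mono) auto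
      then show ?thesis using T(2)[OF that(1), of z] by simp
    qed
    then show ?thesis using T(1) by blast
  qed
  have i: "\<exists>T>0. \<forall>t\<ge>T. \<forall>z\<le>- c * t. u t z \<le> \<epsilon>"
    if asm: "uniformly_bounded_L1_Linf {-h..0} (\<lambda>s x. exp (- \<mu>p * x) * u0 s x)" "c \<ge> cp" "\<epsilon> > 0" for c \<epsilon>
  proof -
    obtain T where T: "T > 0" "\<And>t z. t \<ge> T \<Longrightarrow> \<mu>p * (z + cp * t) \<le> 0 \<Longrightarrow> u t z \<le> \<epsilon>"
      using decay[OF assms(8) asm(1,3)] by blast
    have "u t z \<le> \<epsilon>" if "t \<ge> T" "z \<le> - c * t" for t z
    proof (rule T(2))
      have "cp * t \<le> c * t" using \<open>c \<ge> cp\<close> T(1) that by (intro mult_right_mono) auto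
      then show "\<mu>p * (z + cp * t) \<le> 0"
        using assms(7) that by (intro mult_nonneg_nonpos) auto
    qed fact
    then show ?thesis using T(1) by blast
  qed
  have ii: "\<exists>T>0. \<forall>t\<ge>T. \<forall>z\<ge>- c * t. u t z \<le> \<epsilon>"
    if asm: "uniformly_bounded_L1_Linf {-h..0} (\<lambda>s x. exp (- \<mu>m * x) * u0 s x)" "c \<le> cm" "\<epsilon> > 0" for c \<epsilon>
  proof -
    obtain T where T: "T > 0" "\<And>t z. t \<ge> T \<Longrightarrow> \<mu>m * (z + cm * t) \<le> 0 \<Longrightarrow> u t z \<le> \<epsilon>"
      using decay[OF assms(6) asm(1,3)] by blast
    have "u t z \<le> \<epsilon>" if "t \<ge> T" "z \<ge> - c * t" for t z
    proof (rule T(2))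
      have "c * t \<le> cm * t" using \<open>c \<le> cm\<close> T(1) that by (intro mult_right_mono) auto
      then show "\<mu>m * (z + cm * t) \<le> 0"
        using assms(5) that by (intro mult_nonpos_nonneg) auto
    qed fact
    then show ?thesis using T(1) by blast
  qed
  have iii: "((\<lambda>t. u t z) \<longlongrightarrow> 0) at_top"
    if same_sign: "cp * cm > 0" and bdd: "bounded ((\<lambda>(s, x). u0 s x) ` ({-h..0} \<times> UNIV))"
      and supp: "compact (closure {(s, x). s \<in> {-h..0} \<and> u0 s x \<noteq> 0})" for z
  proof -
    obtain B where "\<forall>v\<in>(\<lambda>(s, x). u0 s x) ` ({-h..0} \<times> UNIV). norm v \<le> B"
      using bdd unfolding bounded_iff by blast
    then have B: "\<bar>u0 s x\<bar> \<le> B" if "s \<in> {-h..0}" for s x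
      using that by auto
    have "bounded {(s, x). s \<in> {-h..0} \<and> u0 s x \<noteq> 0}"
      by (rule bounded_subset[OF compact_imp_bounded[OF supp] closure_subset])
    then obtain R where R: "\<And>s x. s \<in> {-h..0} \<Longrightarrow> u0 s x \<noteq> 0 \<Longrightarrow> norm (s, x) \<le> R"
      unfolding bounded_iff by auto
    have w: "uniformly_bounded_L1_Linf {-h..0} (\<lambda>s x. exp (- l * x) * u0 s x)" for l
    proof (rule uniformly_bounded_L1_Linf_weighted[where B=B and R="max 0 R"])
      show "u0 s \<in> borel_measurable borel" if "s \<in> {-h..0}" for s
        by (rule continuous_into_L1_measurable[OF assms(10) that])
      show "\<bar>x\<bar> \<le> max 0 R" if "s \<in> {-h..0}" "u0 s x \<noteq> 0" for s x
        using R[OF that] norm_snd_le[of x s] by simp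
      show "B \<ge> 0" using B[of 0 0] h by simp
    qed (use B in auto)
    have "\<exists>T. \<forall>t\<ge>T. u t z \<le> \<epsilon>" if \<epsilon>: "\<epsilon> > 0" for \<epsilon>
    \<comment> \<open>If both critical speeds are positive, the half-line of part (ii) sweeps over every point; if both are negative, that of part (i) does.\<close>
    proof (cases "cm > 0")
      case True
      obtain T where T: "\<And>t z. t \<ge> T \<Longrightarrow> z \<ge> - cm * t \<Longrightarrow> u t z \<le> \<epsilon>"
        using ii[OF w order_refl \<epsilon>] by blast
      have "- cm * t \<le> z" if "t \<ge> - z / cm" for t
        using that True by (simp add: field_simps)
      then show ?thesis using T by (intro exI[of _ "max T (- z / cm)"]) auto
    next
      case False
      then have "cp < 0" using same_sign by (auto simp: zero_less_mult_iff)
      obtain T where T: "\<And>t z. t \<ge> T \<Longrightarrow> z \<le> - cp * t \<Longrightarrow> u t z \<le> \<epsilon>"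
        using i[OF w order_refl \<epsilon>] by blast
      have "z \<le> - cp * t" if "t \<ge> - z / cp" for t
        using that \<open>cp < 0\<close> by (simp add: field_simps)
      then show ?thesis using T by (intro exI[of _ "max T (- z / cp)"]) auto
    qed
    note small = this
    show ?thesis
    proof (rule tendstoI)
      fix \<epsilon> :: real assume "\<epsilon> > 0"
      then obtain T where "\<And>t. t \<ge> T \<Longrightarrow> u t z \<le> \<epsilon> / 2" using small[of "\<epsilon> / 2"] by auto
      then have "dist (u t z) 0 < \<epsilon>" if "t \<ge> max 0 T" for t
        using nonneg[of t z] that \<open>\<epsilon> > 0\<close> by (fastforce simp: dist_real_def)
      then show "\<forall>\<^sub>F t in at_top. dist (u t z) 0 < \<epsilon>"
        using eventually_ge_at_top by (rule eventually_mono[rotated])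
    qed
  qed
  show ?thesis
  proof (intro conjI impI allI)
    fix c assume "uniformly_bounded_L1_Linf {-h..0} (\<lambda>s x. exp (- \<mu>p * x) * u0 s x)" "cp \<le> c"
    then show "((\<lambda>t. SUP z\<in>{..- c * t}. ereal (u t z)) \<longlongrightarrow> 0) at_top"
      using i by (intro SUP_ereal_tendsto_0 nonneg) (auto, blast)
  next
    fix c assume "uniformly_bounded_L1_Linf {-h..0} (\<lambda>s x. exp (- \<mu>m * x) * u0 s x)" "c \<le> cm"
    then show "((\<lambda>t. SUP z\<in>{- c * t..}. ereal (u t z)) \<longlongrightarrow> 0) at_top"
      using ii by (intro SUP_ereal_tendsto_0 nonneg) (auto, blast)
  next
    fix z assume "cp * cm > 0 \<and>
          bounded ((\<lambda>(s, x). u0 s x) ` ({-h..0} \<times> UNIV)) \<and>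
          compact (closure {(s, x). s \<in> {-h..0} \<and> u0 s x \<noteq> 0})"
    then show "((\<lambda>t. u t z) \<longlongrightarrow> 0) at_top" using iii by blast
  qed
qed

end
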